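(* Let $p_0\in(0,1)$ be a constant and let $p=p(n)$ satisfy $0<p\le p_0$ and $np/\log n\to\infty$ as $n\to\infty$. Let $A$ be the adjacency matrix of the Erdős–Rényi random graph $G(n,p)$, let $\alpha=(n-1)p-1$, let $H$ be the non-backtracking spectrum operator for $A$, and let $H_0$ be its partial derandomization. Then $\mu_{\frac1{\sqrt\alpha}H}-\mu_{\frac1{\sqrt\alpha}H_0}$ converges almost surely (thus also in probability) to zero as $n\to\infty$.
   Context: $G(n,p)$ is the random graph on $n$ vertices in which each edge $ij$, $i<j$, is present independently with probability $p$, with no loops; $A$ is its $n\times n$ adjacency matrix and $D$ is the diagonal degree matrix, $D_{ii}=\sum_{j=1}^n A_{ij}$. The graphs for different $n$ are defined on a common probability space. With $I$ the $n\times n$ identity, $$H=\begin{pmatrix} A & I-D\\ I & 0\end{pmatrix},\qquad H_0=\begin{pmatrix} A & I-\mathbb E(D)\\ I & 0\end{pmatrix}=\begin{pmatrix} A & -\alpha I\\ I & 0\end{pmatrix},$$ both $2n\times 2n$. $H$ is called the non-backtracking spectrum operator for $A$. (Under the hypotheses $\alpha>0$ for all large $n$.) For an $m\times m$ matrix $M$ with eigenvalues $\lambda_1,\dots,\lambda_m$ (with multiplicity), the empirical spectral measure is $\mu_M=\frac1m\sum_{i=1}^m\delta_{\lambda_i}$, a probability measure on $\mathbb C$. For random probability measures $\nu_n,\nu_n'$ on $\mathbb C$, "$\nu_n-\nu_n'$ converges almost surely to zero" means that for every bounded continuous $f:\mathbb C\to\mathbb R$, $\left|\int f\,d\nu_n-\int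 f\,d\nu_n'\right|\to0$ almost surely; "in probability" is defined analogously, with convergence in probability of these differences. *)

theory Defs
  imports
    "HOL-Probability.Probability"
    "HOL-Computational_Algebra.Fundamental_Theorem_Algebra"
    "Jordan_Normal_Form.Char_Poly"
begin

text \<open>Graphs on the vertices \<open>0, \<dots>, n - 1\<close> are given by their edge sets.
  No relation between the graphs for different \<open>n\<close> is imposed: they only share \<open>M\<close>.\<close>

definition vertex_pairs :: "nat \<Rightarrow> nat set set" where
  "vertex_pairs n = {{i, j} | i j. i < j \<and> j < n}"

definition erdos_renyi :: "'w measure \<Rightarrow> nat \<Rightarrow> real \<Rightarrow> ('w \<Rightarrow> nat set set) \<Rightarrow> bool" where
  "erdos_renyi M n p G \<longleftrightarrow>
     (\<forall>\<omega>\<in>space M. G \<omega> \<subseteq> vertex_pairs n) \<and>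
     prob_space.indep_events M (\<lambda>e. {\<omega> \<in> space M. e \<in> G \<omega>}) (vertex_pairs n) \<and>
     (\<forall>e\<in>vertex_pairs n. measure M {\<omega> \<in> space M. e \<in> G \<omega>} = p)"

definition adjacency_mat :: "nat \<Rightarrow> nat set set \<Rightarrow> real mat" where
  "adjacency_mat n E = Matrix.mat n n (\<lambda>(i, j). if {i, j} \<in> E then 1 else 0)"

definition degree_mat :: "real mat \<Rightarrow> real mat" where
  "degree_mat A = Matrix.mat (dim_row A) (dim_row A)
     (\<lambda>(i, j). if i = j then \<Sum>k<dim_col A. A $$ (i, k) else 0)"

definition expectation_mat :: "'w measure \<Rightarrow> nat \<Rightarrow> ('w \<Rightarrow> real mat) \<Rightarrow> real mat" where
  "expectation_mat M n X = Matrix.mat n n (\<lambda>(i, j). \<integral>\<omega>. X \<omega> $$ (i, j) \<partial>M)"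

definition nonbacktracking_op :: "real mat \<Rightarrow> real mat" where
  "nonbacktracking_op A =
     (let n = dim_row A in
        four_block_mat A (1\<^sub>m n - degree_mat A) (1\<^sub>m n) (0\<^sub>m n n))"

definition partial_derandomization ::
    "'w measure \<Rightarrow> nat \<Rightarrow> ('w \<Rightarrow> real mat) \<Rightarrow> 'w \<Rightarrow> real mat" where
  "partial_derandomization M n A \<omega> =
     four_block_mat (A \<omega>) (1\<^sub>m n - expectation_mat M n (\<lambda>\<omega>'. degree_mat (A \<omega>')))
       (1\<^sub>m n) (0\<^sub>m n n)"

text \<open>The eigenvalues are counted with algebraic multiplicity, as the roots of the
  characteristic polynomial. The discrete \<open>pmf\<close> is pushed to the Borel \<open>\<sigma>\<close>-algebra. For a
  matrix of size 0 the value is meaningless.\<close>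

definition empirical_spectral_measure :: "complex mat \<Rightarrow> complex measure" where
  "empirical_spectral_measure M =
     distr (measure_pmf (pmf_of_multiset (proots (char_poly M)))) borel (\<lambda>z. z)"

lemma sum_mset_image_eq_sum_count:
  fixes f :: "'a \<Rightarrow> real"
  shows "(\<Sum>x\<in>#X. f x) = (\<Sum>x\<in>set_mset X. real (count X x) * f x)"
proof (induction X)
  case (add y X)
  have "(\<Sum>x\<in>set_mset (add_mset y X). real (count (add_mset y X) x) * f x) =
      (\<Sum>x\<in>insert y (set_mset X). real (count X x) * f x + (if x = y then f x else 0))"
    by (intro sum.cong) (auto simp: algebra_simps)
  also have "\<dots> = (\<Sum>x\<in>insert y (set_mset X). real (count X x) * f x) + f y"
    by (simp add: sum.distrib del: sum.insert)
  also have "(\<Sum>x\<in>insert y (set_mset X). real (count X x) * f x) =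
      (\<Sum>x\<in>set_mset X. real (count X x) * f x)"
    by (rule sum.mono_neutral_right) (auto simp: not_in_iff)
  finally show ?case using add.IH by simp
qed simp

lemma integral_empirical_spectral_measure:
  fixes f :: "complex \<Rightarrow> real"
  assumes M: "M \<in> carrier_mat m m" and m: "m > 0" and f: "continuous_on UNIV f"
  shows "integral\<^sup>L (empirical_spectral_measure M) f =
    (\<Sum>z\<in>#proots (char_poly M). f z) / real m"
proof -
  let ?P = "proots (char_poly M)"
  have sz: "size ?P = m"
    using degree_monic_char_poly[OF M] by (simp add: size_proots_complex)
  with m have ne: "?P \<noteq> {#}" by auto
  have "integral\<^sup>L (empirical_spectral_measure M) f =
      measure_pmf.expectation (pmf_of_multiset ?P) f"
    unfolding empirical_spectral_measure_def
    by (rule integral_distr) (use f in \<open>auto intro: borel_measurable_continuous_onI\<close>)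
  also have "\<dots> = (\<Sum>a\<in>set_mset ?P. f a * pmf (pmf_of_multiset ?P) a)"
    by (rule integral_measure_pmf_real) (use ne in \<open>auto simp: set_pmf_of_multiset\<close>)
  also have "\<dots> = (\<Sum>a\<in>set_mset ?P. real (count ?P a) * f a) / real m"
    unfolding sum_divide_distrib by (intro sum.cong) (use ne sz in auto)
  also have "(\<Sum>a\<in>set_mset ?P. real (count ?P a) * f a) = (\<Sum>z\<in>#?P. f z)"
    by (simp add: sum_mset_image_eq_sum_count)
  finally show ?thesis .
qed

definition measures_diff_conv_zero_as ::
    "'w measure \<Rightarrow> (nat \<Rightarrow> 'w \<Rightarrow> complex measure) \<Rightarrow> (nat \<Rightarrow> 'w \<Rightarrow> complex measure) \<Rightarrow> bool" where
  "measures_diff_conv_zero_as M \<nu> \<nu>' \<longleftrightarrow>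
     (\<forall>f :: complex \<Rightarrow> real. continuous_on UNIV f \<longrightarrow> bounded (range f) \<longrightarrow>
        (AE \<omega> in M. (\<lambda>n. \<bar>integral\<^sup>L (\<nu> n \<omega>) f - integral\<^sup>L (\<nu>' n \<omega>) f\<bar>) \<longlonglongrightarrow> 0))"

definition measures_diff_conv_zero_prob ::
    "'w measure \<Rightarrow> (nat \<Rightarrow> 'w \<Rightarrow> complex measure) \<Rightarrow> (nat \<Rightarrow> 'w \<Rightarrow> complex measure) \<Rightarrow> bool" where
  "measures_diff_conv_zero_prob M \<nu> \<nu>' \<longleftrightarrow>
     (\<forall>f :: complex \<Rightarrow> real. continuous_on UNIV f \<longrightarrow> bounded (range f) \<longrightarrow>
        (\<forall>\<epsilon>>0. (\<lambda>n. measure M {\<omega> \<in> space M.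
            \<bar>integral\<^sup>L (\<nu> n \<omega>) f - integral\<^sup>L (\<nu>' n \<omega>) f\<bar> > \<epsilon>}) \<longlonglongrightarrow> 0))"

end

theory Submission
  imports Defs "Jordan_Normal_Form.Schur_Decomposition" "HOL-Real_Asymp.Real_Asymp"
begin

text \<open>Write \<open>B = A / sqrt \<alpha>\<close>. The characteristic polynomials of the two scaled operators are the
determinants of \<open>(z\<^sup>2 + 1) I - z B + E\<close> and \<open>(z\<^sup>2 + 1) I - z B\<close>, where
\<open>E = (D - \<bbbE> D) / \<alpha>\<close> is diagonal. If \<open>n p / ln n\<close> tends to infinity, a Chernoff bound and the
Borel--Cantelli lemma give \<open>max \<bar>E\<^sub>i\<^sub>i\<bar> \<longlonglongrightarrow> 0\<close> almost surely
(\<open>AE_erdos_renyi_degree_concentration\<close>). Everything else is deterministic.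

For \<open>z \<noteq> 0\<close>, the second matrix is \<open>- z (B - (z + 1 / z) I)\<close> with \<open>B\<close> real symmetric, hence normal. It is well
conditioned unless \<open>z + 1 / z\<close> is real, that is, unless \<open>z\<close> is on the real line or the unit circle.
Off this critical set, \<open>E\<close> changes the logarithm of the modulus of the determinant by \<open>o(n)\<close> only
(\<open>abs_ln_det_pencil_diff_le\<close>). The normalized logarithmic potentials of the two spectra therefore
have the same limiting behaviour, and both spectra accumulate only at the critical set
(\<open>det_pencil_eq_0_imp_critical_le\<close>).

It remains to pass from potentials to measures (\<open>logarithmic_replacement\<close>). By Jensen's formula, the
mean of \<open>ln (cmod (w - x))\<close> over a circle of points \<open>w\<close> is a function of \<open>x\<close> that is constant inside of
the circle, and a difference of two such functions for concentric circles is a compactly supported bump;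
convolutions with bumps approximate every continuous function with compact support. A circle meets
the critical set, where the potentials are not controlled. Therefore the circle is replaced by \<open>N\<close>
equally spaced points, rotated so that they all avoid the critical set by a distance that is polynomial
in \<open>1 / N\<close> (\<open>circle_points_off_critical\<close>). The discrete mean is explicit because the product of
the \<open>x - w\<close> is \<open>(x - a) ^ N - r ^ N * \<tau>\<close>, and for \<open>x\<close> near the critical set it differs from the mean over
the circle by \<open>O(ln N / N)\<close> (\<open>ln_circle_product_approx\<close>).

Test functions without compact support require tightness. It suffices to have it for the
derandomized operator, whose eigenvalues are tied to those of \<open>B\<close>, and the sum of the squares of the
latter is the sum of the degrees divided by \<open>\<alpha>\<close>, which is \<open>O(n)\<close> (\<open>card_large_roots_le\<close>).\<close>

section \<open>A quadratic pencil and its diagonal perturbations\<close>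

text \<open>This is \<open>Im (cnj z * (z\<^sup>2 + 1))\<close>. For \<open>z \<noteq> 0\<close> it vanishes exactly when \<open>z + 1 / z\<close> is real,
that is, on the union of the real line and the unit circle. This is where the eigenvalues of the
partially derandomized operator lie.\<close>

definition critical :: "complex \<Rightarrow> real" where
  "critical z = Im z * ((cmod z)\<^sup>2 - 1)"

lemma symmetric_quadratic_form_real:
  fixes b :: "nat \<Rightarrow> nat \<Rightarrow> real" and v :: "nat \<Rightarrow> complex"
  assumes sym: "\<And>i j. i < n \<Longrightarrow> j < n \<Longrightarrow> b i j = b j i"
  shows "Im (\<Sum>i<n. \<Sum>j<n. cnj (v i) * of_real (b i j) * v j) = 0"
proof -
  let ?Q = "\<Sum>i<n. \<Sum>j<n. cnj (v i) * of_real (b i j) * v j"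
  have "cnj ?Q = (\<Sum>i<n. \<Sum>j<n. cnj (v j) * of_real (b i j) * v i)"
    by (simp add: mult_ac)
  also have "\<dots> = (\<Sum>j<n. \<Sum>i<n. cnj (v j) * of_real (b i j) * v i)"
    by (rule sum.swap)
  also have "\<dots> = ?Q"
    by (intro sum.cong refl) (use sym in auto)
  finally show ?thesis
    using cnj.simps(2)[of ?Q] by simp
qed

text \<open>Pairing the equation with \<open>v\<close> and multiplying by \<open>cnj z\<close> turns the term of \<open>b\<close> into
\<open>(cmod z)\<^sup>2\<close> times the value of a real symmetric quadratic form. It drops out of the imaginary part,
where only \<open>critical z\<close> and the diagonal perturbation remain.\<close>

lemma quadratic_pencil_kernel_bound:
  fixes b :: "nat \<Rightarrow> nat \<Rightarrow> real" and e :: "nat \<Rightarrow> real" and v :: "nat \<Rightarrow> complex"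
  assumes sym: "\<And>i j. i < n \<Longrightarrow> j < n \<Longrightarrow> b i j = b j i"
    and e: "\<And>i. i < n \<Longrightarrow> \<bar>e i\<bar> \<le> \<epsilon>"
    and eq: "\<And>i. i < n \<Longrightarrow>
      (z\<^sup>2 + 1) * v i - z * (\<Sum>j<n. of_real (b i j) * v j) + t * of_real (e i) * v i = 0"
    and nz: "\<exists>i<n. v i \<noteq> 0"
  shows "\<bar>critical z\<bar> \<le> cmod t * cmod z * \<epsilon>"
proof -
  define S where "S = (\<Sum>i<n. (cmod (v i))\<^sup>2)"
  define W where "W = (\<Sum>i<n. e i * (cmod (v i))\<^sup>2)"
  define Q where "Q = (\<Sum>i<n. \<Sum>j<n. cnj (v i) * of_real (b i j) * v j)"
  have S: "S > 0"
  proof -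
    obtain i where "i < n" "v i \<noteq> 0" using nz by blast
    then show ?thesis unfolding S_def by (intro sum_pos2[where i=i]) auto
  qed
  have "\<bar>W\<bar> \<le> (\<Sum>i<n. \<bar>e i * (cmod (v i))\<^sup>2\<bar>)" unfolding W_def by (rule sum_abs)
  also have "\<dots> \<le> (\<Sum>i<n. \<epsilon> * (cmod (v i))\<^sup>2)"
    by (intro sum_mono) (use e in \<open>auto simp: abs_mult intro!: mult_right_mono\<close>)
  finally have W: "\<bar>W\<bar> \<le> \<epsilon> * S" by (simp add: S_def sum_distrib_left)
  obtain q where q: "Q = of_real q"
  proof -
    have "Im Q = 0" unfolding Q_def by (rule symmetric_quadratic_form_real) (rule sym)
    then show ?thesis using that[of "Re Q"] by (simp add: complex_eq_iff)
  qed
  have vv: "cnj (v i) * v i = of_real ((cmod (v i))\<^sup>2)" for i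
    by (metis complex_norm_square mult.commute)
  have "0 = (\<Sum>i<n. cnj (v i) * ((z\<^sup>2 + 1) * v i - z * (\<Sum>j<n. of_real (b i j) * v j)
      + t * of_real (e i) * v i))"
    using eq by simp
  also have "\<dots> = (\<Sum>i<n. (z\<^sup>2 + 1) * (cnj (v i) * v i)
      - z * (\<Sum>j<n. cnj (v i) * of_real (b i j) * v j) + t * (of_real (e i) * (cnj (v i) * v i)))"
    by (intro sum.cong refl) (simp add: algebra_simps sum_distrib_left)
  also have "\<dots> = (z\<^sup>2 + 1) * of_real S - z * Q + t * of_real W"
    unfolding vv by (simp add: sum.distrib sum_subtractf S_def W_def Q_def sum_distrib_left)
  finally have "cnj z * ((z\<^sup>2 + 1) * of_real S - z * Q + t * of_real W) = 0" by simp
  then have "Im ((cnj z * z\<^sup>2 + cnj z) * of_real S - (cnj z * z) * of_real q + cnj z * t * of_real W) = 0"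
    unfolding q by (simp add: algebra_simps)
  moreover have "cnj z * z = of_real ((cmod z)\<^sup>2)"
    by (metis complex_norm_square mult.commute)
  moreover from this have "cnj z * z\<^sup>2 = of_real ((cmod z)\<^sup>2) * z"
    by (simp add: power2_eq_square)
  ultimately have "critical z * S + Im (cnj z * t) * W = 0"
    by (simp add: critical_def algebra_simps)
  then have "\<bar>critical z\<bar> * S = \<bar>Im (cnj z * t)\<bar> * \<bar>W\<bar>"
    using S by (metis abs_minus_cancel abs_mult abs_of_pos add_eq_0_iff)
  also have "\<dots> \<le> (cmod t * cmod z) * (\<epsilon> * S)"
    using abs_Im_le_cmod[of "cnj z * t"] by (intro mult_mono W) (auto simp: norm_mult mult.commute)
  finally show ?thesis using S by (simp add: mult_ac)
qed

text \<open>The matrix \<open>(z\<^sup>2 + 1) I - z B + t E\<close> with \<open>E\<close> diagonal. With \<open>B = A / sqrt \<alpha>\<close> and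
\<open>E = (D - (\<alpha> + 1) I) / \<alpha>\<close>, its determinant is the characteristic polynomial of the scaled operator
for \<open>t = 1\<close> and of its partial derandomization for \<open>t = 0\<close>; the parameter \<open>t\<close> interpolates.\<close>

definition pencil :: "nat \<Rightarrow> (nat \<Rightarrow> nat \<Rightarrow> real) \<Rightarrow> (nat \<Rightarrow> real) \<Rightarrow> complex \<Rightarrow> complex \<Rightarrow> complex mat" where
  "pencil n b e t z = Matrix.mat n n
     (\<lambda>(i, j). (if i = j then z\<^sup>2 + 1 + t * of_real (e i) else 0) - z * of_real (b i j))"

lemma pencil_carrier [simp]: "pencil n b e t z \<in> carrier_mat n n"
  by (simp add: pencil_def)

lemma det_pencil_eq_0_imp_critical_le:
  assumes sym: "\<And>i j. i < n \<Longrightarrow> j < n \<Longrightarrow> b i j = b j i"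
    and e: "\<And>i. i < n \<Longrightarrow> \<bar>e i\<bar> \<le> \<epsilon>"
    and det: "det (pencil n b e t z) = 0"
  shows "\<bar>critical z\<bar> \<le> cmod t * cmod z * \<epsilon>"
proof -
  obtain v where v: "v \<in> carrier_vec n" "v \<noteq> 0\<^sub>v n" "pencil n b e t z *\<^sub>v v = 0\<^sub>v n"
    using det_0_iff_vec_prod_zero[OF pencil_carrier, of n b e t z] det by auto
  define w where "w = vec_index v"
  show ?thesis
  proof (rule quadratic_pencil_kernel_bound[where v=w])
    fix i assume i: "i < n"
    have "0 = vec_index (pencil n b e t z *\<^sub>v v) i" using v(3) i by simp
    also have "\<dots> = (\<Sum>j<n. ((if i = j then z\<^sup>2 + 1 + t * of_real (e i) else 0) - z * of_real (b i j)) * w j)"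
      using i v(1) by (simp add: pencil_def scalar_prod_def w_def atLeast0LessThan)
    also have "\<dots> = (\<Sum>j<n. (if i = j then (z\<^sup>2 + 1 + t * of_real (e i)) * w j else 0) - z * (of_real (b i j) * w j))"
      by (intro sum.cong) (auto simp: algebra_simps)
    also have "\<dots> = (z\<^sup>2 + 1) * w i - z * (\<Sum>j<n. of_real (b i j) * w j) + t * of_real (e i) * w i"
      using i by (simp add: sum_subtractf sum_distrib_left algebra_simps)
    finally show "(z\<^sup>2 + 1) * w i - z * (\<Sum>j<n. of_real (b i j) * w j) + t * of_real (e i) * w i = 0" ..
  next
    show "\<exists>i<n. w i \<noteq> 0" using v(1,2) by (auto simp: w_def)
  qed (use sym e in auto)
qed

lemma complex_poly_eq_prod_roots:
  "poly p z = lead_coeff p * (\<Prod>x\<in>#proots p. z - x)" for p :: "complex poly"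
  by (subst complex_poly_decompose_multiset[symmetric], subst poly_smult)
     (simp add: poly_prod_mset)

lemma abs_ln_cmod_one_minus_le:
  assumes "cmod u \<le> x" "x < 1"
  shows "\<bar>ln (cmod (1 - u))\<bar> \<le> - ln (1 - x)"
proof -
  have 1: "1 - x \<le> cmod (1 - u)"
    using norm_triangle_ineq2[of 1 u] assms by simp
  have "cmod (1 - u) \<le> 1 + x"
    using norm_triangle_ineq4[of 1 u] assms by simp
  then have "ln (cmod (1 - u)) \<le> ln (1 + x)" using 1 assms by (intro ln_mono) auto
  also have "ln (1 + x) \<le> - ln (1 - x)"
  proof -
    have "x \<ge> 0" using assms(1) norm_ge_zero order_trans by blast
    have "(1 + x) * (1 - x) \<le> 1" by (simp add: algebra_simps)
    then have "ln ((1 + x) * (1 - x)) \<le> ln 1"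
      using assms \<open>x \<ge> 0\<close> by (intro ln_mono) auto
    then show ?thesis using assms \<open>x \<ge> 0\<close> by (simp add: ln_mult)
  qed
  finally have "ln (cmod (1 - u)) \<le> - ln (1 - x)" .
  moreover have "ln (1 - x) \<le> ln (cmod (1 - u))"
    using 1 assms by (intro ln_mono) auto
  ultimately show ?thesis by linarith
qed

text \<open>By factorization, \<open>Q 1 / Q 0\<close> is the product of \<open>1 - 1 / t\<close> over the roots \<open>t\<close>, and each factor lies within
\<open>x\<close> of \<open>1\<close>.\<close>

lemma abs_ln_poly_ratio_le:
  fixes Q :: "complex poly"
  assumes deg: "degree Q \<le> n" and x: "x < 1" "0 \<le> x" and Q0: "poly Q 0 \<noteq> 0"
    and roots: "\<And>t. poly Q t = 0 \<Longrightarrow> 1 \<le> x * cmod t"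
  shows "\<bar>ln (cmod (poly Q 1)) - ln (cmod (poly Q 0))\<bar> \<le> real n * (- ln (1 - x))"
proof -
  have lnx: "ln (1 - x) \<le> 0" using x by simp
  let ?R = "proots Q"
  have nz: "Q \<noteq> 0" using Q0 by auto
  have R: "1 \<le> x * cmod t" if "t \<in># ?R" for t
    using that roots nz by auto
  have *: "(\<forall>t\<in>#R. 1 \<le> x * cmod t) \<Longrightarrow>
     (\<Prod>t\<in>#R. 0 - t) \<noteq> 0 \<and> (\<Prod>t\<in>#R. 1 - t) \<noteq> 0 \<and>
     \<bar>ln (cmod (\<Prod>t\<in>#R. 1 - t)) - ln (cmod (\<Prod>t\<in>#R. 0 - t))\<bar> \<le> real (size R) * (- ln (1 - x))" for R
  proof (induction R)
    case (add t R)
    have t: "1 \<le> x * cmod t" using add.prems by simp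
    then have t0: "t \<noteq> 0" by auto
    have "cmod (1 / t) \<le> x" using t t0 by (simp add: norm_divide field_simps)
    then have L: "\<bar>ln (cmod (1 - 1 / t))\<bar> \<le> - ln (1 - x)"
      by (rule abs_ln_cmod_one_minus_le) (rule x)
    have t1: "t \<noteq> 1" using t x by auto
    have "1 - t = - t * (1 - 1 / t)" using t0 by (simp add: field_simps)
    then have "cmod (1 - t) = cmod t * cmod (1 - 1 / t)" by (simp only: norm_mult norm_minus_cancel)
    moreover have "1 - 1 / t \<noteq> 0" using t1 t0 by auto
    ultimately have "ln (cmod (1 - t)) - ln (cmod t) = ln (cmod (1 - 1/t))"
      using t0 by (simp add: ln_mult)
    with L have L': "\<bar>ln (cmod (1 - t)) - ln (cmod t)\<bar> \<le> - ln (1 - x)" by simp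
    have IH: "(\<Prod>t\<in>#R. 0 - t) \<noteq> 0" "(\<Prod>t\<in>#R. 1 - t) \<noteq> 0" 
      "\<bar>ln (cmod (\<Prod>t\<in>#R. 1 - t)) - ln (cmod (\<Prod>t\<in>#R. 0 - t))\<bar> \<le> real (size R) * (- ln (1 - x))"
      using add by auto
    show ?case
    proof (intro conjI)
      show "(\<Prod>t\<in>#add_mset t R. 0 - t) \<noteq> 0" using IH t0 by simp
      show "(\<Prod>t\<in>#add_mset t R. 1 - t) \<noteq> 0" using IH t1 by simp
      have "ln (cmod (\<Prod>t\<in>#add_mset t R. 1 - t)) = ln (cmod (1 - t)) + ln (cmod (\<Prod>t\<in>#R. 1 - t))"
        using IH t1 by (simp add: norm_mult ln_mult)
      moreover have "ln (cmod (\<Prod>t\<in>#add_mset t R. 0 - t)) = ln (cmod t) + ln (cmod (\<Prod>t\<in>#R. 0 - t))"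
        using IH t0 by (simp add: norm_mult ln_mult)
      moreover have "real (size (add_mset t R)) * (- ln (1 - x)) = - ln (1 - x) + real (size R) * (- ln (1 - x))"
        by (simp add: algebra_simps)
      ultimately show "\<bar>ln (cmod (\<Prod>t\<in>#add_mset t R. 1 - t)) - ln (cmod (\<Prod>t\<in>#add_mset t R. 0 - t))\<bar>
          \<le> real (size (add_mset t R)) * (- ln (1 - x))"
        using IH(3) L' by linarith
    qed
  qed auto
  have lc: "lead_coeff Q \<noteq> 0" using nz by simp
  have P: "(\<Prod>t\<in>#?R. 0 - t) \<noteq> 0" "(\<Prod>t\<in>#?R. 1 - t) \<noteq> 0"
     "\<bar>ln (cmod (\<Prod>t\<in>#?R. 1 - t)) - ln (cmod (\<Prod>t\<in>#?R. 0 - t))\<bar> \<le> real (size ?R) * (- ln (1 - x))"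
    using *[of ?R] R by blast+
  have "ln (cmod (poly Q 1)) - ln (cmod (poly Q 0)) =
      ln (cmod (\<Prod>t\<in>#?R. 1 - t)) - ln (cmod (\<Prod>t\<in>#?R. 0 - t))"
    unfolding complex_poly_eq_prod_roots[of Q] norm_mult
    using P(1,2) lc by (subst (1 2) ln_mult) (simp_all only: zero_less_norm_iff norm_eq_zero, simp_all)
  also have "\<bar>\<dots>\<bar> \<le> real (size ?R) * (- ln (1 - x))" by (rule P(3))
  also have "\<dots> \<le> real n * (- ln (1 - x))"
    using deg lnx by (intro mult_right_mono) (auto simp: size_proots_complex)
  finally show ?thesis .
qed

text \<open>The determinant is a polynomial in \<open>t\<close> of degree at most \<open>n\<close>, and the kernel bound keeps its roots
far from the origin: the pencil at \<open>t = 0\<close> is normal and thus well conditioned at every \<open>z\<close>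
that is not critical, so a small perturbation cannot make it singular.\<close>

lemma abs_ln_det_pencil_diff_le:
  assumes sym: "\<And>i j. i < n \<Longrightarrow> j < n \<Longrightarrow> b i j = b j i"
    and e: "\<And>i. i < n \<Longrightarrow> \<bar>e i\<bar> \<le> \<epsilon>" and "0 \<le> \<epsilon>"
    and small: "cmod z * \<epsilon> < \<bar>critical z\<bar>"
  shows "\<bar>ln (cmod (det (pencil n b e 1 z))) - ln (cmod (det (pencil n b e 0 z)))\<bar>
     \<le> real n * (- ln (1 - cmod z * \<epsilon> / \<bar>critical z\<bar>))"
proof -
  define PM where "PM = Matrix.mat n n
     (\<lambda>(i, j). (if i = j then [:z\<^sup>2 + 1, of_real (e i):] else 0) - [:z * of_real (b i j):])"
  have PM: "PM \<in> carrier_mat n n" by (simp add: PM_def)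
  have poly: "poly (det PM) t = det (pencil n b e t z)" for t
  proof -
    have ev: "comm_ring_hom (\<lambda>p::complex poly. poly p t)" by unfold_locales auto
    have "map_mat (\<lambda>p. poly p t) PM = pencil n b e t z"
      by (rule eq_matI) (auto simp: PM_def pencil_def)
    then show ?thesis by (metis comm_ring_hom.hom_det[OF ev])
  qed
  have c0: "\<bar>critical z\<bar> > 0" using small \<open>0 \<le> \<epsilon>\<close> by (meson norm_ge_zero mult_nonneg_nonneg le_less_trans)
  have "degree (det PM) \<le> 1 * n"
    by (rule degree_det_le[OF _ PM]) (auto simp: PM_def intro!: degree_diff_le)
  then have deg: "degree (det PM) \<le> n" by simp
  show ?thesis unfolding poly[symmetric]
  proof (rule abs_ln_poly_ratio_le[OF deg])
    show "cmod z * \<epsilon> / \<bar>critical z\<bar> < 1" using small c0 by simp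
    show "0 \<le> cmod z * \<epsilon> / \<bar>critical z\<bar>" using \<open>0 \<le> \<epsilon>\<close> by simp
    show "poly (det PM) 0 \<noteq> 0"
      using det_pencil_eq_0_imp_critical_le[OF sym e, where t=0 and z=z] c0 by (auto simp: poly)
    fix t assume "poly (det PM) t = 0"
    then have "\<bar>critical z\<bar> \<le> cmod t * cmod z * \<epsilon>"
      using det_pencil_eq_0_imp_critical_le[OF sym e, where t=t and z=z] by (auto simp: poly)
    then show "1 \<le> cmod z * \<epsilon> / \<bar>critical z\<bar> * cmod t"
      using c0 by (simp add: field_simps)
  qed
qed

lemma poly_char_poly_eq_det:
  fixes A :: "complex mat"
  assumes A: "A \<in> carrier_mat n n"
  shows "poly (char_poly A) z = det (Matrix.mat n n (\<lambda>(i, j). (if i = j then z else 0) - A $$ (i, j)))"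
proof -
  have ev: "comm_ring_hom (\<lambda>p::complex poly. poly p z)" by unfold_locales auto
  have "map_mat (\<lambda>p. poly p z) (char_poly_matrix A)
      = Matrix.mat n n (\<lambda>(i, j). (if i = j then z else 0) - A $$ (i, j))"
    by (rule eq_matI) (use A in \<open>auto simp: char_poly_matrix_def\<close>)
  then show ?thesis unfolding char_poly_def by (metis comm_ring_hom.hom_det[OF ev])
qed

text \<open>The lower blocks commute, so the determinant of the block matrix is that of an \<open>n \<times> n\<close> matrix, and this
one is quadratic in \<open>z\<close>. The same diagonal \<open>e\<close> with \<open>t = 1\<close> and \<open>t = 0\<close> covers both operators, which is
why \<open>e\<close> and \<open>t\<close> enter only through their product.\<close>

lemma poly_char_poly_companion_block:
  fixes a :: "nat \<Rightarrow> nat \<Rightarrow> real" and d :: "nat \<Rightarrow> real" and s :: real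
  assumes s: "s \<noteq> 0"
    and e: "\<And>i. i < n \<Longrightarrow> of_real (e i) * t = (complex_of_real ((d i - 1) / s\<^sup>2 - 1))"
  defines "A \<equiv> Matrix.mat n n (\<lambda>(i, j). a i j)"
    and "D \<equiv> Matrix.mat n n (\<lambda>(i, j). if i = j then d i else 0)"
  shows "poly (char_poly (map_mat complex_of_real
       ((1 / s) \<cdot>\<^sub>m four_block_mat A (1\<^sub>m n - D) (1\<^sub>m n) (0\<^sub>m n n)))) z
     = det (pencil n (\<lambda>i j. a i j / s) e t z)"
proof -
  define X where "X = map_mat complex_of_real
       ((1 / s) \<cdot>\<^sub>m four_block_mat A (1\<^sub>m n - D) (1\<^sub>m n) (0\<^sub>m n n))"
  define S :: complex where "S = of_real s"
  have S0: "S \<noteq> 0" using s by (simp add: S_def)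
  have X: "X \<in> carrier_mat (n + n) (n + n)"
    unfolding X_def A_def D_def by (auto simp: four_block_mat_def Let_def)
  define A' where "A' = Matrix.mat n n (\<lambda>(i, j). (if i = j then z else 0) - of_real (a i j) / S)"
  define B' where "B' = Matrix.mat n n (\<lambda>(i, j). if i = j then (of_real (d i) - 1) / S else 0)"
  define C' where "C' = (- 1 / S) \<cdot>\<^sub>m (1\<^sub>m n :: complex mat)"
  define D' where "D' = z \<cdot>\<^sub>m (1\<^sub>m n :: complex mat)"
  have dims [simp]: "A' \<in> carrier_mat n n" "B' \<in> carrier_mat n n" "C' \<in> carrier_mat n n" "D' \<in> carrier_mat n n"
    by (auto simp: A'_def B'_def C'_def D'_def)
  have blk: "Matrix.mat (n + n) (n + n) (\<lambda>(i, j). (if i = j then z else 0) - X $$ (i, j))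
      = four_block_mat A' B' C' D'"
    by (rule eq_matI)
       (auto simp: X_def A_def D_def A'_def B'_def C'_def D'_def S_def diff_divide_distrib)
  have comm: "C' * D' = D' * C'"
    unfolding C'_def D'_def
    by (rule eq_matI) (auto simp: mult_ac)
  have prod: "A' * D' - B' * C' = pencil n (\<lambda>i j. a i j / s) e t z"
  proof -
    have 1: "A' * D' = z \<cdot>\<^sub>m A'"
      unfolding D'_def using dims(1) by (metis mult_smult_distrib one_carrier_mat right_mult_one_mat)
    have 2: "B' * C' = (- 1 / S) \<cdot>\<^sub>m B'"
      unfolding C'_def using dims(2) by (metis mult_smult_distrib one_carrier_mat right_mult_one_mat)
    show ?thesis unfolding 1 2
    proof (rule eq_matI)
      fix i j assume "i < dim_row (pencil n (\<lambda>i j. a i j / s) e t z)" "j < dim_col (pencil n (\<lambda>i j. a i j / s) e t z)"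
      then have ij: "i < n" "j < n" by (auto simp: pencil_def)
      have "t * of_real (e i) = (of_real (d i) - 1) / S\<^sup>2 - 1"
        using e[OF ij(1)] by (simp add: S_def mult.commute)
      then show "(z \<cdot>\<^sub>m A' - (- 1 / S) \<cdot>\<^sub>m B') $$ (i, j) = pencil n (\<lambda>i j. a i j / s) e t z $$ (i, j)"
        using ij S0 by (auto simp: A'_def B'_def pencil_def S_def[symmetric] power2_eq_square right_diff_distrib)
    qed (auto simp: pencil_def A'_def B'_def)
  qed
  show ?thesis
    unfolding X_def[symmetric] poly_char_poly_eq_det[OF X] blk
    by (subst det_four_block_mat[OF dims comm]) (simp add: prod)
qed

section \<open>Eigenvalues of large modulus\<close>

definition mat_trace :: "'a :: comm_ring_1 mat \<Rightarrow> 'a" where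
  "mat_trace X = (\<Sum>i<dim_row X. X $$ (i, i))"

lemma mat_trace_mult_commute:
  assumes "X \<in> carrier_mat n n" "Y \<in> carrier_mat n n"
  shows "mat_trace (X * Y) = mat_trace (Y * X)"
proof -
  have "mat_trace (X * Y) = (\<Sum>i<n. \<Sum>j<n. X $$ (i, j) * Y $$ (j, i))"
    using assms by (auto simp: mat_trace_def scalar_prod_def atLeast0LessThan)
  also have "\<dots> = (\<Sum>j<n. \<Sum>i<n. X $$ (i, j) * Y $$ (j, i))" by (rule sum.swap)
  also have "\<dots> = mat_trace (Y * X)"
    using assms by (auto simp: mat_trace_def scalar_prod_def atLeast0LessThan mult.commute)
  finally show ?thesis .
qed

lemma upper_triangular_square_diag:
  fixes T :: "'a :: comm_ring_1 mat"
  assumes T: "T \<in> carrier_mat n n" "upper_triangular T" and i: "i < n"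
  shows "(T * T) $$ (i, i) = (T $$ (i, i))\<^sup>2"
proof -
  have "(T * T) $$ (i, i) = (\<Sum>j<n. T $$ (i, j) * T $$ (j, i))"
    using T(1) i by (auto simp: scalar_prod_def atLeast0LessThan)
  also have "\<dots> = (\<Sum>j<n. if i = j then (T $$ (i, i))\<^sup>2 else 0)"
  proof (intro sum.cong refl)
    fix j assume "j \<in> {..<n}"
    then show "T $$ (i, j) * T $$ (j, i) = (if i = j then (T $$ (i, i))\<^sup>2 else 0)"
      using T i upper_triangularD[OF T(2), of j i] upper_triangularD[OF T(2), of i j]
      by (cases i j rule: linorder_cases) (auto simp: power2_eq_square)
  qed
  finally show ?thesis using i by simp
qed

text \<open>Schur triangularization gives the determinants and, through the trace of the square, the sum of the
squares of the diagonal entries. These entries are eigenvalues and hence real, so the sum of their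
squares controls the size of the spectrum.\<close>

lemma real_symmetric_spectrum:
  fixes b :: "nat \<Rightarrow> nat \<Rightarrow> real"
  assumes sym: "\<And>i j. i < n \<Longrightarrow> j < n \<Longrightarrow> b i j = b j i"
  shows "\<exists>mu :: nat \<Rightarrow> real.
    (\<forall>c d. det (Matrix.mat n n (\<lambda>(i, j). (if i = j then c else 0) - d * complex_of_real (b i j)))
        = (\<Prod>i<n. c - d * complex_of_real (mu i))) \<and>
    (\<Sum>i<n. (mu i)\<^sup>2) = (\<Sum>i<n. \<Sum>j<n. (b i j)\<^sup>2)"
proof -
  define X where "X = Matrix.mat n n (\<lambda>(i, j). complex_of_real (b i j))"
  have X: "X \<in> carrier_mat n n" by (simp add: X_def)
  obtain es where es: "char_poly X = (\<Prod>a\<leftarrow>es. [:- a, 1:])"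
    using char_poly_factorized[OF X] by blast
  obtain T P Q where TPQ: "schur_decomposition X es = (T, P, Q)"
    by (cases "schur_decomposition X es") auto
  have sim: "similar_mat_wit X T P Q" and ut: "upper_triangular T"
    using schur_decomposition[OF X es TPQ] by auto
  note w = similar_mat_witD2[OF X sim]
  have T: "T \<in> carrier_mat n n" and P: "P \<in> carrier_mat n n" and Q: "Q \<in> carrier_mat n n"
    and PQ: "P * Q = 1\<^sub>m n" and QP: "Q * P = 1\<^sub>m n" and XT: "X = P * T * Q"
    using w by auto
  have det_PQ: "det P * det Q = 1"
    using det_mult[OF P Q] PQ by simp
  have det: "det (Matrix.mat n n (\<lambda>(i, j). (if i = j then c else 0) - d * complex_of_real (b i j)))
     = (\<Prod>i<n. c - d * T $$ (i, i))" for c d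
  proof -
    define Y where "Y = c \<cdot>\<^sub>m 1\<^sub>m n - d \<cdot>\<^sub>m T"
    have Y: "Y \<in> carrier_mat n n" using T by (auto simp: Y_def)
    have "P * Y * Q = (c \<cdot>\<^sub>m P - d \<cdot>\<^sub>m (P * T)) * Q"
      unfolding Y_def using P T
      by (subst mult_minus_distrib_mat[of _ n n _ n]) (auto simp: mult_smult_distrib[of _ n n _ n])
    also have "\<dots> = c \<cdot>\<^sub>m 1\<^sub>m n - d \<cdot>\<^sub>m X"
      using P T Q unfolding XT
      by (subst minus_mult_distrib_mat[of _ n n _ _ n])
         (auto simp: PQ mult_smult_assoc_mat[of _ n n _ n])
    also have "\<dots> = Matrix.mat n n (\<lambda>(i, j). (if i = j then c else 0) - d * complex_of_real (b i j))"
      by (rule eq_matI) (auto simp: X_def)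
    finally have "det (Matrix.mat n n (\<lambda>(i, j). (if i = j then c else 0) - d * complex_of_real (b i j)))
       = det (P * Y * Q)" by simp
    also have "\<dots> = det P * det Y * det Q"
      using det_mult[of "P * Y" n Q] det_mult[OF P Y] P Q Y by simp
    also have "\<dots> = det Y" using det_PQ by (simp add: mult_ac)
    also have "det Y = prod_list (diag_mat Y)"
      by (rule det_upper_triangular[OF _ Y])
         (use T ut in \<open>auto simp: Y_def upper_triangular_def\<close>)
    also have "\<dots> = (\<Prod>i<n. Y $$ (i, i))"
      using Y by (simp add: prod_list_diag_prod atLeast0LessThan)
    also have "\<dots> = (\<Prod>i<n. c - d * T $$ (i, i))"
      using T by (intro prod.cong) (auto simp: Y_def)
    finally show ?thesis .
  qed
  have real: "Im (T $$ (i, i)) = 0" if i: "i < n" for i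
  proof -
    define l where "l = T $$ (i, i)"
    let ?M = "Matrix.mat n n (\<lambda>(i, j). (if i = j then l else 0) - 1 * complex_of_real (b i j))"
    have "det ?M = 0" unfolding det using i by (auto simp: l_def)
    then obtain v where v: "v \<in> carrier_vec n" "v \<noteq> 0\<^sub>v n" "?M *\<^sub>v v = 0\<^sub>v n"
      using det_0_iff_vec_prod_zero[of ?M n] by auto
    define w where "w = vec_index v"
    have eq: "l * w i = (\<Sum>j<n. of_real (b i j) * w j)" if i: "i < n" for i
    proof -
      have "0 = vec_index (?M *\<^sub>v v) i" using v(3) i by simp
      also have "\<dots> = (\<Sum>j<n. ((if i = j then l else 0) - of_real (b i j)) * w j)"
        using i v(1) by (simp add: scalar_prod_def w_def atLeast0LessThan)
      also have "\<dots> = (\<Sum>j<n. (if i = j then l * w j else 0) - of_real (b i j) * w j)"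
        by (intro sum.cong) (auto simp: algebra_simps)
      also have "\<dots> = l * w i - (\<Sum>j<n. of_real (b i j) * w j)"
        using i by (simp add: sum_subtractf)
      finally show ?thesis by simp
    qed
    define S where "S = (\<Sum>i<n. (cmod (w i))\<^sup>2)"
    have S: "S > 0"
    proof -
      have "\<exists>k<n. w k \<noteq> 0" using v(1,2) by (auto simp: w_def)
      then obtain k where "k < n" "w k \<noteq> 0" by blast
      then show ?thesis unfolding S_def by (intro sum_pos2[where i=k]) auto
    qed
    have vv: "cnj (w i) * w i = of_real ((cmod (w i))\<^sup>2)" for i
      by (metis complex_norm_square mult.commute)
    have "l * of_real S = (\<Sum>i<n. l * (cnj (w i) * w i))"
      unfolding vv S_def by (simp add: sum_distrib_left)
    also have "\<dots> = (\<Sum>i<n. cnj (w i) * (\<Sum>j<n. of_real (b i j) * w j))"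
    proof (rule sum.cong[OF refl])
      fix i assume "i \<in> {..<n}"
      then show "l * (cnj (w i) * w i) = cnj (w i) * (\<Sum>j<n. of_real (b i j) * w j)"
        using eq[of i] by (metis lessThan_iff mult.left_commute)
    qed
    also have "\<dots> = (\<Sum>i<n. \<Sum>j<n. cnj (w i) * of_real (b i j) * w j)"
      by (simp add: sum_distrib_left mult.assoc)
    finally have "Im (l * of_real S) = 0"
      using symmetric_quadratic_form_real[of n b w] sym by simp
    then show ?thesis using S by (simp add: l_def)
  qed
  have sum: "(\<Sum>i<n. (T $$ (i, i))\<^sup>2) = of_real (\<Sum>i<n. \<Sum>j<n. (b i j)\<^sup>2)"
  proof -
    have "(\<Sum>i<n. (T $$ (i, i))\<^sup>2) = mat_trace (T * T)"
      using T upper_triangular_square_diag[OF T ut] by (simp add: mat_trace_def)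
    also have "T * T = (T * T) * (Q * P)" using T QP by simp
    also have "\<dots> = ((T * T) * Q) * P"
      using T Q P by (simp add: assoc_mult_mat[of _ n n _ n _ n])
    also have "mat_trace \<dots> = mat_trace (P * ((T * T) * Q))"
      using T Q P by (intro mat_trace_mult_commute[of _ n]) auto
    also have "P * ((T * T) * Q) = X * X"
    proof -
      have "X * X = P * (T * ((Q * P) * (T * Q)))"
        unfolding XT using T Q P by (simp add: assoc_mult_mat[of _ n n _ n _ n] mult_carrier_mat[of _ n n _ n])
      also have "\<dots> = P * ((T * T) * Q)"
        unfolding QP using T Q P
        by (simp add: assoc_mult_mat[of _ n n _ n _ n] mult_carrier_mat[of _ n n _ n] left_mult_one_mat[of _ n n])
      finally show ?thesis ..
    qed
    also have "mat_trace (X * X) = (\<Sum>i<n. \<Sum>j<n. complex_of_real (b i j) * complex_of_real (b j i))"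
      by (simp add: mat_trace_def X_def scalar_prod_def atLeast0LessThan)
    also have "\<dots> = (\<Sum>i<n. \<Sum>j<n. complex_of_real ((b i j)\<^sup>2))"
      by (intro sum.cong refl) (use sym in \<open>auto simp: power2_eq_square\<close>)
    finally show ?thesis by simp
  qed
  define mu where "mu = (\<lambda>i. Re (T $$ (i, i)))"
  have mu: "T $$ (i, i) = of_real (mu i)" if "i < n" for i
    using real[OF that] by (simp add: mu_def complex_eq_iff)
  show ?thesis
  proof (intro exI[of _ mu] conjI allI)
    have "complex_of_real (\<Sum>i<n. (mu i)\<^sup>2) = of_real (\<Sum>i<n. \<Sum>j<n. (b i j)\<^sup>2)"
      unfolding sum[symmetric] using mu by simp
    then show "(\<Sum>i<n. (mu i)\<^sup>2) = (\<Sum>i<n. \<Sum>j<n. (b i j)\<^sup>2)"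
      by (simp only: of_real_eq_iff)
  qed (simp add: det mu)
qed

lemma critical_eq_0_iff: "critical z = 0 \<longleftrightarrow> Im z = 0 \<or> cmod z = 1"
  by (auto simp: critical_def power2_eq_1_iff) (metis norm_ge_zero not_one_le_zero zero_le_one neg_0_le_iff_le)

text \<open>A tightness estimate. At \<open>z = \<i> y\<close> every root on the real line or on the unit circle has distance at least
\<open>y - 1\<close> from \<open>z\<close>, and a real root of modulus larger than \<open>y\<close> has distance at least \<open>sqrt 2 * y\<close>.
The determinant, in turn, is the product of
\<open>sqrt ((y\<^sup>2 - 1)\<^sup>2 + y\<^sup>2 \<mu>\<^sup>2)\<close> over the eigenvalues \<open>\<mu>\<close> of \<open>b\<close>, which is at most \<open>(y\<^sup>2 - 1) ^ n\<close> up to a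
factor governed by the sum of the squares of \<open>b\<close>. Comparing the two leaves little room for large roots.\<close>

lemma card_large_roots_le:
  fixes b :: "nat \<Rightarrow> nat \<Rightarrow> real" and Y :: "complex multiset" and y :: real
  assumes sym: "\<And>i j. i < n \<Longrightarrow> j < n \<Longrightarrow> b i j = b j i"
    and Y: "\<And>z. (\<Prod>x\<in>#Y. z - x) = det (pencil n b e 0 z)" and sz: "size Y = 2 * n"
    and y: "1 < y"
  shows "real (size {#x \<in># Y. cmod x > y#}) * (ln 2 / 2) \<le>
     real n * ln ((y + 1) / (y - 1)) + (y / (y\<^sup>2 - 1))\<^sup>2 / 2 * (\<Sum>i<n. \<Sum>j<n. (b i j)\<^sup>2)"
proof -
  obtain mu where mu: "\<And>c d. det (Matrix.mat n n (\<lambda>(i, j). (if i = j then c else 0) - d * complex_of_real (b i j)))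
        = (\<Prod>i<n. c - d * complex_of_real (mu i))"
    "(\<Sum>i<n. (mu i)\<^sup>2) = (\<Sum>i<n. \<Sum>j<n. (b i j)\<^sup>2)"
    using real_symmetric_spectrum[of n b, OF sym] by auto
  define z where "z = \<i> * of_real y"
  define N where "N = size {#x \<in># Y. cmod x > y#}"
  have y2: "y\<^sup>2 > 1" using y by simp
  have root: "Im x = 0 \<or> cmod x = 1" if "x \<in># Y" for x
  proof -
    have "(\<Prod>w\<in>#Y. x - w) = 0" using that by (auto simp: prod_mset_zero_iff)
    then have "det (pencil n b e 0 x) = 0" using Y by simp
    then have "\<bar>critical x\<bar> \<le> cmod 0 * cmod x * Max (insert 0 ((\<lambda>i. \<bar>e i\<bar>) ` {..<n}))"
      by (intro det_pencil_eq_0_imp_critical_le[where n=n and b=b and e=e]) (use sym in auto)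
    then show ?thesis by (simp add: critical_eq_0_iff)
  qed
  have "(y - 1) ^ size Y * sqrt 2 ^ size {#x \<in># Y. cmod x > y#} \<le> (\<Prod>x\<in>#Y. cmod (z - x))"
    using root
  proof (induction Y)
    case (add x Y)
    have IH: "(y - 1) ^ size Y * sqrt 2 ^ size {#x \<in># Y. cmod x > y#} \<le> (\<Prod>x\<in>#Y. cmod (z - x))"
      using add by simp
    have far: "y - 1 \<le> cmod (z - x)" "cmod x > y \<Longrightarrow> (y - 1) * sqrt 2 \<le> cmod (z - x)"
    proof -
      have "cmod x = 1 \<Longrightarrow> y - 1 \<le> cmod (z - x)"
        using norm_triangle_ineq2[of z x] y by (simp add: z_def norm_mult)
      moreover have re: "(cmod (z - x))\<^sup>2 = (cmod x)\<^sup>2 + y\<^sup>2" if "Im x = 0"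
        using that by (simp add: z_def cmod_power2)
      moreover have "y - 1 \<le> cmod (z - x)" if "Im x = 0"
      proof -
        have "(y - 1)\<^sup>2 \<le> y\<^sup>2" using y by (intro power_mono) auto
        also have "\<dots> \<le> (cmod (z - x))\<^sup>2" using re[OF that] by simp
        finally show ?thesis using y by (simp add: power2_le_iff_abs_le)
      qed
      ultimately show "y - 1 \<le> cmod (z - x)" using add.prems[of x] by auto
      show "(y - 1) * sqrt 2 \<le> cmod (z - x)" if "cmod x > y"
      proof -
        have "Im x = 0" using that y add.prems[of x] by auto
        have "((y - 1) * sqrt 2)\<^sup>2 = 2 * (y - 1)\<^sup>2" by (simp add: power_mult_distrib)
        also have "(y - 1)\<^sup>2 \<le> y\<^sup>2" using y by (intro power_mono) auto
        also have "2 * y\<^sup>2 \<le> (cmod x)\<^sup>2 + y\<^sup>2" using that y power_mono[of y "cmod x" 2] by simp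
        also have "\<dots> = (cmod (z - x))\<^sup>2" using re[OF \<open>Im x = 0\<close>] by simp
        finally show ?thesis using y by (simp add: power2_le_iff_abs_le abs_mult)
      qed
    qed
    show ?case
    proof (cases "cmod x > y")
      case True
      have "((y - 1) * sqrt 2) * ((y - 1) ^ size Y * sqrt 2 ^ size {#x \<in># Y. cmod x > y#})
         \<le> cmod (z - x) * (\<Prod>x\<in>#Y. cmod (z - x))"
        using far(2)[OF True] IH y by (intro mult_mono) auto
      then show ?thesis using True by (simp add: mult_ac)
    next
      case False
      have "(y - 1) * ((y - 1) ^ size Y * sqrt 2 ^ size {#x \<in># Y. cmod x > y#})
         \<le> cmod (z - x) * (\<Prod>x\<in>#Y. cmod (z - x))"
        using far(1) IH y by (intro mult_mono) auto
      then show ?thesis using False by (simp add: mult_ac)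
    qed
  qed auto
  also have "(\<Prod>x\<in>#Y. cmod (z - x)) = cmod (\<Prod>x\<in>#Y. z - x)"
    by (induction Y) (auto simp: norm_mult)
  also have "\<dots> = cmod (\<Prod>i<n. (z\<^sup>2 + 1) - z * complex_of_real (mu i))"
    unfolding Y mu(1)[symmetric] by (simp only: pencil_def mult_zero_left add_0_right)
  also have "\<dots> = (\<Prod>i<n. cmod ((z\<^sup>2 + 1) - z * complex_of_real (mu i)))"
    by (simp add: prod_norm)
  also have "\<dots> = (\<Prod>i<n. (y\<^sup>2 - 1) * sqrt (1 + (y / (y\<^sup>2 - 1))\<^sup>2 * (mu i)\<^sup>2))"
  proof (rule prod.cong[OF refl])
    fix i
    have "(cmod ((z\<^sup>2 + 1) - z * complex_of_real (mu i)))\<^sup>2 = (1 - y\<^sup>2)\<^sup>2 + (y * mu i)\<^sup>2"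
      by (simp add: z_def cmod_power2 power_mult_distrib)
    also have "\<dots> = (y\<^sup>2 - 1)\<^sup>2 * (1 + (y / (y\<^sup>2 - 1))\<^sup>2 * (mu i)\<^sup>2)"
      using y2 by (simp add: power_divide distrib_left power_mult_distrib power2_commute)
    finally have "cmod ((z\<^sup>2 + 1) - z * complex_of_real (mu i)) = sqrt ((y\<^sup>2 - 1)\<^sup>2 * (1 + (y / (y\<^sup>2 - 1))\<^sup>2 * (mu i)\<^sup>2))"
      by (metis norm_ge_zero real_sqrt_unique)
    then show "cmod ((z\<^sup>2 + 1) - z * complex_of_real (mu i)) = (y\<^sup>2 - 1) * sqrt (1 + (y / (y\<^sup>2 - 1))\<^sup>2 * (mu i)\<^sup>2)"
      using y2 by (simp add: real_sqrt_mult)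
  qed
  finally have main: "(y - 1) ^ (2 * n) * sqrt 2 ^ N \<le> (\<Prod>i<n. (y\<^sup>2 - 1) * sqrt (1 + (y / (y\<^sup>2 - 1))\<^sup>2 * (mu i)\<^sup>2))"
    unfolding N_def sz .
  have pos1: "1 + (y / (y\<^sup>2 - 1))\<^sup>2 * (mu i)\<^sup>2 > 0" for i
    by (rule add_pos_nonneg) auto
  have "ln ((y - 1) ^ (2 * n) * sqrt 2 ^ N) \<le> ln (\<Prod>i<n. (y\<^sup>2 - 1) * sqrt (1 + (y / (y\<^sup>2 - 1))\<^sup>2 * (mu i)\<^sup>2))"
    using main y by (intro ln_mono) auto
  also have "\<dots> = (\<Sum>i<n. ln ((y\<^sup>2 - 1) * sqrt (1 + (y / (y\<^sup>2 - 1))\<^sup>2 * (mu i)\<^sup>2)))"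
    using y2 pos1 by (subst ln_prod) (auto simp: less_imp_neq[symmetric])
  also have "\<dots> \<le> (\<Sum>i<n. ln (y\<^sup>2 - 1) + (y / (y\<^sup>2 - 1))\<^sup>2 / 2 * (mu i)\<^sup>2)"
  proof (rule sum_mono)
    fix i
    have "ln ((y\<^sup>2 - 1) * sqrt (1 + (y / (y\<^sup>2 - 1))\<^sup>2 * (mu i)\<^sup>2)) =
      ln (y\<^sup>2 - 1) + ln (1 + (y / (y\<^sup>2 - 1))\<^sup>2 * (mu i)\<^sup>2) / 2"
      using y2 pos1[of i] by (subst ln_mult) (auto simp: ln_sqrt less_imp_neq[symmetric])
    moreover have "ln (1 + (y / (y\<^sup>2 - 1))\<^sup>2 * (mu i)\<^sup>2) \<le> (y / (y\<^sup>2 - 1))\<^sup>2 * (mu i)\<^sup>2"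
      by (rule ln_add_one_self_le_self) auto
    ultimately show "ln ((y\<^sup>2 - 1) * sqrt (1 + (y / (y\<^sup>2 - 1))\<^sup>2 * (mu i)\<^sup>2)) \<le> ln (y\<^sup>2 - 1) + (y / (y\<^sup>2 - 1))\<^sup>2 / 2 * (mu i)\<^sup>2"
      by simp
  qed
  also have "\<dots> = real n * ln (y\<^sup>2 - 1) + (y / (y\<^sup>2 - 1))\<^sup>2 / 2 * (\<Sum>i<n. (mu i)\<^sup>2)"
    by (simp add: sum.distrib sum_distrib_left)
  finally have key: "2 * real n * ln (y - 1) + real N * (ln 2 / 2) \<le>
      real n * ln (y\<^sup>2 - 1) + (y / (y\<^sup>2 - 1))\<^sup>2 / 2 * (\<Sum>i<n. \<Sum>j<n. (b i j)\<^sup>2)"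
    using y by (simp add: mu(2) ln_mult ln_realpow ln_sqrt)
  have L1: "ln (y\<^sup>2 - 1) = ln (y + 1) + ln (y - 1)"
  proof -
    have "y\<^sup>2 - 1 = (y + 1) * (y - 1)" by (simp add: power2_eq_square algebra_simps)
    then show ?thesis using y by (simp add: ln_mult)
  qed
  have L2: "ln ((y + 1) / (y - 1)) = ln (y + 1) - ln (y - 1)"
    using y by (simp add: ln_div)
  show ?thesis
    using key unfolding N_def[symmetric] L1 L2 distrib_left right_diff_distrib by linarith
qed

section \<open>Equally spaced points on circles\<close>

text \<open>The integral against the uniform probability measure on a multiset, such as the multiset of the
eigenvalues of a matrix; it is \<open>0\<close> for the empty multiset.\<close>

definition mset_mean :: "('a \<Rightarrow> real) \<Rightarrow> 'a multiset \<Rightarrow> real" where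
  "mset_mean f X = (\<Sum>x\<in>#X. f x) / real (size X)"

lemma mset_mean_add: "mset_mean (\<lambda>x. f x + g x) X = mset_mean f X + mset_mean g X"
  by (simp add: mset_mean_def sum_mset.distrib add_divide_distrib)

lemma mset_mean_diff: "mset_mean (\<lambda>x. f x - g x) X = mset_mean f X - mset_mean g X"
  using mset_mean_add[of "\<lambda>x. f x - g x" g X] by simp

lemma mset_mean_mono:
  assumes "\<And>x. x \<in># X \<Longrightarrow> f x \<le> g x"
  shows "mset_mean f X \<le> mset_mean g X"
  unfolding mset_mean_def by (intro divide_right_mono sum_mset_mono assms) auto

lemma mset_mean_const: "X \<noteq> {#} \<Longrightarrow> mset_mean (\<lambda>x. c) X = c"
  by (simp add: mset_mean_def)

lemma abs_mset_mean_diff_le: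
  assumes "\<And>x. x \<in># X \<Longrightarrow> \<bar>f x - g x\<bar> \<le> c" "0 \<le> c"
  shows "\<bar>mset_mean f X - mset_mean g X\<bar> \<le> c"
proof (cases "X = {#}")
  case False
  have "\<bar>mset_mean f X - mset_mean g X\<bar> = \<bar>mset_mean (\<lambda>x. f x - g x) X\<bar>"
    by (simp add: mset_mean_diff)
  also have "\<dots> \<le> c"
  proof (rule abs_leI)
    show "mset_mean (\<lambda>x. f x - g x) X \<le> c"
      using mset_mean_mono[of X "\<lambda>x. f x - g x" "\<lambda>x. c"] assms False
      by (force simp: mset_mean_const abs_le_iff)
    have "mset_mean (\<lambda>x. - c) X \<le> mset_mean (\<lambda>x. f x - g x) X"
      using assms by (intro mset_mean_mono) (force simp: abs_le_iff)
    then show "- mset_mean (\<lambda>x. f x - g x) X \<le> c"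
      using False by (simp add: mset_mean_const)
  qed
  finally show ?thesis .
qed (use assms in \<open>simp add: mset_mean_def\<close>)

text \<open>If \<open>v ^ N\<close> is close to \<open>1\<close>, its logarithm \<open>s\<close> is small, and then \<open>v * exp (- s / N)\<close> is an \<open>N\<close>th root of
unity close to \<open>v\<close>.\<close>

lemma root_of_unity_distance:
  fixes v :: complex
  assumes N: "1 \<le> N" and d: "\<And>\<omega>. \<omega> ^ N = 1 \<Longrightarrow> d \<le> cmod (v - \<omega>)"
  shows "min (1 / 2) (d / 6) \<le> cmod (v ^ N - 1)"
proof (rule ccontr)
  define x where "x = v ^ N - 1"
  define s where "s = Ln (1 + x)"
  assume "\<not> ?thesis"
  then have x: "cmod x < 1 / 2" "6 * cmod x < d" by (auto simp: x_def)
  have ne: "1 + x \<noteq> 0"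
  proof
    assume "1 + x = 0"
    then have "x = -1" by (simp add: add_eq_0_iff)
    then show False using x by simp
  qed
  then have es: "exp s = v ^ N" by (simp add: s_def x_def)
  have "cmod (s - x) \<le> (cmod x)\<^sup>2 / (1 - cmod x)"
    unfolding s_def by (rule Ln_approx_linear) (use x in auto)
  also have "\<dots> \<le> cmod x"
  proof -
    have "(cmod x)\<^sup>2 \<le> cmod x * (1 - cmod x)"
      unfolding power2_eq_square using x by (intro mult_left_mono) auto
    then show ?thesis using x by (simp add: field_simps)
  qed
  finally have s: "cmod s \<le> 2 * cmod x"
    using norm_triangle_ineq2[of s x] by linarith
  define u where "u = s / of_nat N"
  have u: "cmod u \<le> 2 * cmod x"
  proof -
    have "cmod u \<le> cmod s"
      using divide_left_mono[of 1 "real N" "cmod s"] N by (simp add: u_def norm_divide)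
    then show ?thesis using s by simp
  qed
  define \<omega> where "\<omega> = v * exp (- u)"
  have "\<omega> ^ N = v ^ N * exp (of_nat N * (- u))"
    by (simp only: \<omega>_def power_mult_distrib exp_of_nat_mult)
  also have "of_nat N * (- u) = - s" using N by (simp add: u_def)
  also have "v ^ N * exp (- s) = 1" unfolding es[symmetric] by (simp add: exp_minus)
  finally have w: "\<omega> ^ N = 1" .
  have cw: "cmod \<omega> = 1"
  proof -
    have "cmod \<omega> ^ N = 1" using w by (metis norm_one norm_power)
    then show ?thesis using power_eq_imp_eq_base[of "cmod \<omega>" N 1] N by simp
  qed
  have "v = \<omega> * exp u" by (simp add: \<omega>_def exp_minus)
  then have "v - \<omega> = \<omega> * (exp u - 1)" by (simp add: algebra_simps)
  then have "cmod (v - \<omega>) = cmod (exp u - 1)" by (simp add: norm_mult cw)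
  also have "\<dots> \<le> exp \<bar>Re u\<bar> * cmod u"
    using Taylor_exp[of u 0] by simp
  also have "\<dots> \<le> 3 * cmod u"
  proof -
    have "\<bar>Re u\<bar> \<le> 1" using abs_Re_le_cmod[of u] u x by linarith
    then have "exp \<bar>Re u\<bar> \<le> exp 1" by simp
    also have "\<dots> \<le> (3::real)" by (rule exp_le)
    finally show ?thesis by (intro mult_right_mono) auto
  qed
  also have "\<dots> < d" using u x by linarith
  finally show False using d[OF w] by simp
qed

lemma circle_points_exist:
  fixes a \<rho> :: complex
  assumes N: "1 \<le> N"
  obtains Z where "size Z = N" "\<And>z. (\<Prod>w\<in>#Z. z - w) = (z - a) ^ N - \<rho>"
proof -
  define p where "p = [:- a, 1:] ^ N + [:- \<rho>:]"
  have deg: "degree p = N"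
    unfolding p_def using N
    by (subst degree_add_eq_left) (auto simp: degree_linear_power)
  have lc: "lead_coeff p = 1"
  proof -
    have "coeff ([:- a, 1:] ^ N) N = 1"
      using lead_coeff_power[of "[:- a, 1:]" N] by (simp add: degree_linear_power)
    then show ?thesis unfolding deg unfolding p_def using N by (cases N) simp_all
  qed
  show ?thesis
  proof (rule that[of "proots p"])
    show "size (proots p) = N" by (simp add: size_proots_complex deg)
    show "(\<Prod>w\<in>#proots p. z - w) = (z - a) ^ N - \<rho>" for z
      using complex_poly_eq_prod_roots[of p z] lc by (simp add: p_def)
  qed
qed

text \<open>The mean of \<open>ln (cmod (w - x))\<close> over a full circle of \<open>w\<close> around \<open>a\<close> with radius \<open>r\<close> is
\<open>ln (max r (cmod (x - a)))\<close> by Jensen's formula. Here the circle is replaced by \<open>N\<close> equally spaced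
points \<open>w\<close>, for which the product of the distances to \<open>x\<close> is explicit. After division by
\<open>N\<close>, the bound says that the discrete mean is \<open>O(ln N / N)\<close> away from Jensen's value even if the
distance \<open>\<delta>\<close> from \<open>x\<close> to these points is only polynomial in \<open>1 / N\<close>.\<close>

lemma ln_circle_product_approx:
  fixes a \<tau> x :: complex
  assumes N: "1 \<le> N" and r: "0 < r" and \<tau>: "cmod \<tau> = 1" and \<delta>: "0 < \<delta>" "\<delta> \<le> r"
    and far: "\<And>w. (w - a) ^ N = of_real r ^ N * \<tau> \<Longrightarrow> \<delta> \<le> cmod (x - w)"
  shows "\<bar>ln (cmod ((x - a) ^ N - of_real r ^ N * \<tau>)) - real N * ln (max r (cmod (x - a)))\<bar>
    \<le> ln (12 * r / \<delta>)"
proof -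
  define \<zeta> where "\<zeta> = exp (Ln \<tau> / of_nat N)"
  have \<tau>0: "\<tau> \<noteq> 0" using \<tau> by auto
  have \<zeta>: "\<zeta> ^ N = \<tau>"
    using N \<tau>0 by (simp add: \<zeta>_def exp_of_nat_mult[symmetric])
  have c\<zeta>: "cmod \<zeta> = 1" using \<tau> \<tau>0 by (simp add: \<zeta>_def Re_Ln)
  have \<zeta>0: "\<zeta> \<noteq> 0" by (simp add: \<zeta>_def)
  define v where "v = (x - a) / (of_real r * \<zeta>)"
  have xa: "x - a = of_real r * \<zeta> * v" using r \<zeta>0 by (simp add: v_def)
  have "\<delta> / r \<le> cmod (v - \<omega>)" if "\<omega> ^ N = 1" for \<omega>
  proof -
    have "\<delta> \<le> cmod (x - (a + of_real r * \<zeta> * \<omega>))"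
      by (rule far) (simp add: power_mult_distrib \<zeta> that)
    also have "x - (a + of_real r * \<zeta> * \<omega>) = of_real r * \<zeta> * (v - \<omega>)"
      using xa by (simp add: algebra_simps)
    also have "cmod \<dots> = r * cmod (v - \<omega>)" using r by (simp add: norm_mult c\<zeta>)
    finally show ?thesis using r by (simp add: field_simps)
  qed
  from root_of_unity_distance[OF N this]
  have m: "min (1/2) (\<delta> / r / 6) \<le> cmod (v ^ N - 1)" .
  define m where "m = \<delta> / (6 * r)"
  have m1: "0 < m" "m \<le> 1 / 6" using \<delta> r by (auto simp: m_def field_simps)
  have mQ: "m \<le> cmod (v ^ N - 1)" using m m1 by (auto simp: m_def)
  define q where "q = cmod (v ^ N)"
  have low: "m / 2 * max 1 q \<le> cmod (v ^ N - 1)"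
  proof (cases "q \<le> 2")
    case True
    have "m / 2 * max 1 q \<le> m / 2 * 2" using True m1 by (intro mult_left_mono) auto
    then show ?thesis using mQ by simp
  next
    case False
    have "m / 2 * max 1 q \<le> 1 / 2 * q" using False m1 by (intro mult_mono) auto
    also have "\<dots> \<le> q - 1" using False by simp
    also have "\<dots> \<le> cmod (v ^ N - 1)" unfolding q_def using norm_triangle_ineq2[of "v ^ N" 1] by simp
    finally show ?thesis .
  qed
  have up: "cmod (v ^ N - 1) \<le> 2 * max 1 q"
    using norm_triangle_ineq4[of "v ^ N" 1] by (simp add: q_def)
  have "(x - a) ^ N - of_real r ^ N * \<tau> = of_real r ^ N * \<tau> * (v ^ N - 1)"
    unfolding xa by (simp add: power_mult_distrib \<zeta> algebra_simps)
  then have c1: "cmod ((x - a) ^ N - of_real r ^ N * \<tau>) = r ^ N * cmod (v ^ N - 1)"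
    using r \<tau> by (simp add: norm_mult norm_power)
  have "max r (cmod (x - a)) = r * max 1 (cmod v)"
    unfolding xa using r c\<zeta> by (simp add: norm_mult max_def)
  moreover have "max 1 (cmod v) ^ N = max 1 q"
    by (cases "cmod v \<le> 1") (auto simp: q_def norm_power max_def power_le_one one_le_power intro: antisym)
  ultimately have "max r (cmod (x - a)) ^ N = r ^ N * max 1 q"
    by (simp add: power_mult_distrib)
  moreover have "real N * ln (max r (cmod (x - a))) = ln (max r (cmod (x - a)) ^ N)"
    using r by (simp add: ln_realpow)
  ultimately have c2: "real N * ln (max r (cmod (x - a))) = ln (r ^ N * max 1 q)" by simp
  have "ln (cmod ((x - a) ^ N - of_real r ^ N * \<tau>)) - real N * ln (max r (cmod (x - a)))
      = ln (cmod (v ^ N - 1)) - ln (max 1 q)"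
    unfolding c1 c2 using r mQ m1 by (subst (1 2) ln_mult) auto
  moreover have "ln (cmod (v ^ N - 1)) \<le> ln (2 * max 1 q)"
    using up mQ m1 by (intro ln_mono) auto
  moreover have "ln (2 * max 1 q) = ln 2 + ln (max 1 q)"
    by (subst ln_mult) auto
  moreover have "ln 2 \<le> ln (12 * r / \<delta>)"
    using r \<delta> by (intro ln_mono) (auto simp: field_simps)
  moreover have "ln (m / 2 * max 1 q) \<le> ln (cmod (v ^ N - 1))"
    using low m1 mQ by (intro ln_mono) auto
  moreover have "ln (m / 2 * max 1 q) = ln (m / 2) + ln (max 1 q)"
    using m1 by (subst ln_mult) auto
  moreover have "ln (m / 2) = - ln (12 * r / \<delta>)"
  proof -
    have "m / 2 = inverse (12 * r / \<delta>)" using r \<delta> by (simp add: m_def field_simps)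
    moreover have "0 < 12 * r / \<delta>" using r \<delta> by simp
    ultimately show ?thesis by (simp only: ln_inverse)
  qed
  ultimately show ?thesis by linarith
qed

text \<open>Among five points of the circle with pairwise distances at least \<open>6 / 10\<close>, each \<open>w\<close> is too close to at
most one.\<close>

lemma unit_circle_avoids_four_points:
  fixes W :: "complex set"
  assumes "finite W" "card W \<le> 4"
  obtains \<tau> where "cmod \<tau> = 1" "\<And>w. w \<in> W \<Longrightarrow> 3 / 10 \<le> cmod (\<tau> - w)"
proof -
  define C where "C = {1, -1, \<i>, -\<i>, Complex (3/5) (4/5)}"
  have card: "card C = 5"
    by (simp add: C_def complex_eq_iff)
  have unit: "cmod c = 1" if "c \<in> C" for c
    using that by (auto simp: C_def cmod_def power_divide)
  have sep: "6 / 10 \<le> cmod (c - d)" if "c \<in> C" "d \<in> C" "c \<noteq> d" for c d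
  proof -
    have "(6 / 10)\<^sup>2 \<le> (cmod (c - d))\<^sup>2"
      using that unfolding C_def cmod_power2
      by (elim insertE emptyE) (simp_all add: power2_eq_square)
    then show ?thesis by (rule power2_le_imp_le) auto
  qed
  have "\<exists>\<tau>\<in>C. \<forall>w\<in>W. 3 / 10 \<le> cmod (\<tau> - w)"
  proof (rule ccontr)
    assume "\<not> ?thesis"
    then have "\<forall>\<tau>\<in>C. \<exists>w\<in>W. cmod (\<tau> - w) < 3 / 10" by (auto simp: not_le)
    then obtain h where h: "\<And>\<tau>. \<tau> \<in> C \<Longrightarrow> h \<tau> \<in> W \<and> cmod (\<tau> - h \<tau>) < 3 / 10" by metis
    have "inj_on h C"
    proof (rule inj_onI, rule ccontr)
      fix c d assume cd: "c \<in> C" "d \<in> C" "h c = h d" "c \<noteq> d"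
      have "cmod (c - d) \<le> cmod (c - h c) + cmod (d - h d)"
        using norm_triangle_ineq4[of "c - h c" "d - h d"] cd(3) by simp
      then show False using h[OF cd(1)] h[OF cd(2)] sep[OF cd(1,2,4)] by linarith
    qed
    then have "card C \<le> card W"
      by (rule card_inj_on_le) (use h assms in auto)
    then show False using card assms by simp
  qed
  then show ?thesis using that unit by blast
qed

text \<open>On the unit circle, \<open>2 * \<xi> * (s + Re (b * \<xi>))\<close> is the quadratic polynomial \<open>b * \<xi>\<^sup>2 + 2 * s * \<xi> + cnj b\<close>.
A root outside of the closed disc may be reflected into it, since this only decreases the distances
to the points of the circle.\<close>

lemma real_affine_on_circle_factor:
  fixes s :: real and b :: complex
  assumes "s \<noteq> 0 \<or> b \<noteq> 0"
  shows "\<exists>c>0. \<exists>\<xi>1 \<xi>2. cmod \<xi>1 \<le> 1 \<and> cmod \<xi>2 \<le> 1 \<and>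
    (\<forall>\<xi>. cmod \<xi> = 1 \<longrightarrow> c * (cmod (\<xi> - \<xi>1) * cmod (\<xi> - \<xi>2)) \<le> \<bar>s + Re (b * \<xi>)\<bar>)"
proof (cases "b = 0")
  case True
  then have s: "s \<noteq> 0" using assms by simp
  show ?thesis
  \<comment> \<open>The function is constant, and two points of the circle have distance at most \<open>2\<close>.\<close>
  proof (intro exI[of _ "\<bar>s\<bar> / 4"] conjI exI[of _ 1] allI impI)
    fix \<xi> :: complex assume "cmod \<xi> = 1"
    then have "cmod (\<xi> - 1) \<le> 2" using norm_triangle_ineq4[of \<xi> 1] by simp
    then have "cmod (\<xi> - 1) * cmod (\<xi> - 1) \<le> 2 * 2" by (intro mult_mono) auto
    then have "\<bar>s\<bar> / 4 * (cmod (\<xi> - 1) * cmod (\<xi> - 1)) \<le> \<bar>s\<bar> / 4 * 4"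
      by (intro mult_left_mono) auto
    then show "\<bar>s\<bar> / 4 * (cmod (\<xi> - 1) * cmod (\<xi> - 1)) \<le> \<bar>s + Re (b * \<xi>)\<bar>"
      using True by simp
  qed (use s in auto)
next
  case False
  define D where "D = csqrt ((of_real s)\<^sup>2 - b * cnj b)"
  \<comment> \<open>\<open>\<eta>1\<close> and \<open>\<eta>2\<close> are the two roots, by the quadratic formula.\<close>
  define \<eta>1 where "\<eta>1 = (- of_real s + D) / b"
  define \<eta>2 where "\<eta>2 = (- of_real s - D) / b"
  have D2: "D * D = (of_real s)\<^sup>2 - b * cnj b"
    unfolding D_def by (metis power2_csqrt power2_eq_square)
  have inside: "\<exists>\<eta>'. cmod \<eta>' \<le> 1 \<and> (\<forall>\<xi>. cmod \<xi> = 1 \<longrightarrow> cmod (\<xi> - \<eta>') \<le> cmod (\<xi> - \<eta>))" for \<eta>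
  proof (cases "cmod \<eta> \<le> 1")
    case False
    then have \<eta>0: "\<eta> \<noteq> 0" by auto
    show ?thesis
    proof (intro exI[of _ "1 / cnj \<eta>"] conjI allI impI)
      show "cmod (1 / cnj \<eta>) \<le> 1" using False by (simp add: norm_divide divide_le_eq)
      fix \<xi> :: complex assume \<xi>: "cmod \<xi> = 1"
      then have \<xi>': "\<xi> * cnj \<xi> = 1" by (simp add: complex_norm_square[symmetric])
      have "cnj (\<xi> - 1 / cnj \<eta>) * (\<xi> * \<eta>) = (\<xi> * cnj \<xi>) * \<eta> - \<xi>"
        using \<eta>0 by (simp add: field_simps)
      then have "cnj (\<xi> - 1 / cnj \<eta>) * (\<xi> * \<eta>) = \<eta> - \<xi>" using \<xi>' by simp
      then have "cmod (\<xi> - 1 / cnj \<eta>) * cmod \<eta> = cmod (\<xi> - \<eta>)"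
        using \<xi> by (metis complex_mod_cnj mult_1 norm_minus_commute norm_mult)
      moreover have "cmod (\<xi> - 1 / cnj \<eta>) * 1 \<le> cmod (\<xi> - 1 / cnj \<eta>) * cmod \<eta>"
        using False by (intro mult_left_mono) auto
      ultimately show "cmod (\<xi> - 1 / cnj \<eta>) \<le> cmod (\<xi> - \<eta>)" by simp
    qed
  qed auto
  obtain \<xi>1 where x1: "cmod \<xi>1 \<le> 1" "\<And>\<xi>. cmod \<xi> = 1 \<Longrightarrow> cmod (\<xi> - \<xi>1) \<le> cmod (\<xi> - \<eta>1)"
    using inside[of \<eta>1] by blast
  obtain \<xi>2 where x2: "cmod \<xi>2 \<le> 1" "\<And>\<xi>. cmod \<xi> = 1 \<Longrightarrow> cmod (\<xi> - \<xi>2) \<le> cmod (\<xi> - \<eta>2)"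
    using inside[of \<eta>2] by blast
  have "cmod b / 2 * (cmod (\<xi> - \<xi>1) * cmod (\<xi> - \<xi>2)) \<le> \<bar>s + Re (b * \<xi>)\<bar>"
    if \<xi>: "cmod \<xi> = 1" for \<xi>
  proof -
    have \<xi>': "\<xi> * cnj \<xi> = 1" using \<xi> by (simp add: complex_norm_square[symmetric])
    have "of_real (2 * Re (b * \<xi>)) = b * \<xi> + cnj b * cnj \<xi>"
      by (simp add: complex_eq_iff)
    then have "\<xi> * of_real (2 * (s + Re (b * \<xi>))) = 2 * of_real s * \<xi> + b * \<xi> * \<xi> + cnj b * (\<xi> * cnj \<xi>)"
      by (simp add: algebra_simps)
    also have "\<dots> = b * ((\<xi> - \<eta>1) * (\<xi> - \<eta>2))"
    proof -
      have "b * ((\<xi> - \<eta>1) * (\<xi> - \<eta>2)) = (b * \<xi> + of_real s - D) * (b * \<xi> + of_real s + D) / b"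
        using False by (simp add: \<eta>1_def \<eta>2_def field_simps)
      also have "(b * \<xi> + of_real s - D) * (b * \<xi> + of_real s + D) = (b * \<xi> + of_real s)\<^sup>2 - D * D"
        by (simp add: algebra_simps power2_eq_square)
      also have "\<dots> = b * (b * \<xi> * \<xi> + 2 * of_real s * \<xi> + cnj b)"
        unfolding D2 by (simp add: algebra_simps power2_eq_square)
      also have "\<dots> / b = b * \<xi> * \<xi> + 2 * of_real s * \<xi> + cnj b" using False by simp
      finally show ?thesis using \<xi>' by (simp add: algebra_simps)
    qed
    finally have "cmod (\<xi> * of_real (2 * (s + Re (b * \<xi>)))) = cmod (b * ((\<xi> - \<eta>1) * (\<xi> - \<eta>2)))"
      by simp
    then have "2 * \<bar>s + Re (b * \<xi>)\<bar> = cmod b * (cmod (\<xi> - \<eta>1) * cmod (\<xi> - \<eta>2))"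
      by (simp only: norm_mult norm_of_real \<xi> abs_mult)
    moreover have "cmod (\<xi> - \<xi>1) * cmod (\<xi> - \<xi>2) \<le> cmod (\<xi> - \<eta>1) * cmod (\<xi> - \<eta>2)"
      using x1(2)[OF \<xi>] x2(2)[OF \<xi>] by (intro mult_mono) auto
    then have "cmod b * (cmod (\<xi> - \<xi>1) * cmod (\<xi> - \<xi>2)) \<le> cmod b * (cmod (\<xi> - \<eta>1) * cmod (\<xi> - \<eta>2))"
      by (intro mult_left_mono) auto
    ultimately show ?thesis by simp
  qed
  moreover have "cmod b / 2 > 0" using False by simp
  ultimately show ?thesis using x1(1) x2(1) by blast
qed

text \<open>Both factors of \<open>critical\<close> are real affine functions on the circle, so \<open>critical\<close> is small only near
at most four directions \<open>\<xi>1, \<dots>, \<xi>4\<close> in the closed unit disc. Since \<open>\<xi> \<mapsto> \<xi> ^ N\<close> expands distances in this disc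
by a factor of at most \<open>N\<close>, the points whose direction has \<open>N\<close>th power \<open>\<tau>\<close> all avoid the four
directions once \<open>\<tau>\<close> avoids the four powers. The radius \<open>1\<close> is excluded because for \<open>a = 0\<close> the function
vanishes on the whole circle.\<close>

lemma circle_points_off_critical:
  fixes a :: complex and r :: real
  assumes r: "0 < r" "r \<noteq> 1"
  obtains c where "0 < c"
    "\<And>N. 1 \<le> N \<Longrightarrow> \<exists>\<tau>. cmod \<tau> = 1 \<and>
      (\<forall>z. (z - a) ^ N = of_real r ^ N * \<tau> \<longrightarrow> c / real N ^ 4 \<le> \<bar>critical z\<bar>)"
proof -
  obtain c1 \<xi>1 \<xi>2 where 1: "c1 > 0" "cmod \<xi>1 \<le> 1" "cmod \<xi>2 \<le> 1"
    "\<And>\<xi>. cmod \<xi> = 1 \<Longrightarrow> c1 * (cmod (\<xi> - \<xi>1) * cmod (\<xi> - \<xi>2)) \<le> \<bar>Im a + Re ((- \<i> * of_real r) * \<xi>)\<bar>"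
    using real_affine_on_circle_factor[of "Im a" "- \<i> * of_real r"] r by auto
  have "(cmod a)\<^sup>2 + r\<^sup>2 - 1 \<noteq> 0 \<or> 2 * of_real r * cnj a \<noteq> 0"
    using r by (auto simp: power2_eq_1_iff)
  from real_affine_on_circle_factor[OF this]
  obtain c2 \<xi>3 \<xi>4 where 2: "c2 > 0" "cmod \<xi>3 \<le> 1" "cmod \<xi>4 \<le> 1"
    "\<And>\<xi>. cmod \<xi> = 1 \<Longrightarrow> c2 * (cmod (\<xi> - \<xi>3) * cmod (\<xi> - \<xi>4)) \<le> \<bar>(cmod a)\<^sup>2 + r\<^sup>2 - 1 + Re ((2 * of_real r * cnj a) * \<xi>)\<bar>"
    by blast
  define c where "c = c1 * c2 * (3 / 10) ^ 4"
  show ?thesis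
  proof (rule that[of c])
    show "c > 0" using 1 2 by (simp add: c_def)
    fix N :: nat assume N: "1 \<le> N"
    obtain \<tau> where \<tau>: "cmod \<tau> = 1" "\<And>w. w \<in> {\<xi>1 ^ N, \<xi>2 ^ N, \<xi>3 ^ N, \<xi>4 ^ N} \<Longrightarrow> 3 / 10 \<le> cmod (\<tau> - w)"
    proof (rule unit_circle_avoids_four_points[of "{\<xi>1 ^ N, \<xi>2 ^ N, \<xi>3 ^ N, \<xi>4 ^ N}"])
      show "card {\<xi>1 ^ N, \<xi>2 ^ N, \<xi>3 ^ N, \<xi>4 ^ N} \<le> 4"
        using card_length[of "[\<xi>1 ^ N, \<xi>2 ^ N, \<xi>3 ^ N, \<xi>4 ^ N]"] by simp
    qed auto
    show "\<exists>\<tau>. cmod \<tau> = 1 \<and> (\<forall>z. (z - a) ^ N = of_real r ^ N * \<tau> \<longrightarrow> c / real N ^ 4 \<le> \<bar>critical z\<bar>)"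
    proof (intro exI[of _ \<tau>] conjI allI impI \<tau>(1))
      fix z assume z: "(z - a) ^ N = of_real r ^ N * \<tau>"
      define \<xi> where "\<xi> = (z - a) / of_real r"
      have zx: "z = a + of_real r * \<xi>" using r by (simp add: \<xi>_def)
      have \<xi>N: "\<xi> ^ N = \<tau>" using z r by (simp add: \<xi>_def power_divide)
      then have "cmod \<xi> ^ N = 1" using \<tau>(1) by (metis norm_power)
      then have \<xi>: "cmod \<xi> = 1" using power_eq_imp_eq_base[of "cmod \<xi>" N 1] N by simp
      have dist: "3 / 10 / real N \<le> cmod (\<xi> - w)" if "cmod w \<le> 1" "w ^ N \<in> {\<xi>1 ^ N, \<xi>2 ^ N, \<xi>3 ^ N, \<xi>4 ^ N}" for w
      proof -
        have "3 / 10 \<le> cmod (\<xi> ^ N - w ^ N)" unfolding \<xi>N by (rule \<tau>(2)[OF that(2)])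
        also have "\<dots> \<le> real N * cmod (\<xi> - w)" by (rule norm_power_diff) (use \<xi> that in auto)
        finally show ?thesis using N by (simp add: field_simps)
      qed
      define h where "h = 3 / 10 / real N"
      have h0: "h \<ge> 0" by (simp add: h_def)
      have "c1 * (h * h) \<le> c1 * (cmod (\<xi> - \<xi>1) * cmod (\<xi> - \<xi>2))"
        using 1 dist[of \<xi>1] dist[of \<xi>2] h0 by (intro mult_left_mono mult_mono) (auto simp: h_def)
      also have "\<dots> \<le> \<bar>Im a + Re ((- \<i> * of_real r) * \<xi>)\<bar>" by (rule 1(4)[OF \<xi>])
      also have "Im a + Re ((- \<i> * of_real r) * \<xi>) = Im z" by (simp add: zx)
      finally have A: "c1 * (h * h) \<le> \<bar>Im z\<bar>" .
      have "c2 * (h * h) \<le> c2 * (cmod (\<xi> - \<xi>3) * cmod (\<xi> - \<xi>4))"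
        using 2 dist[of \<xi>3] dist[of \<xi>4] h0 by (intro mult_left_mono mult_mono) (auto simp: h_def)
      also have "\<dots> \<le> \<bar>(cmod a)\<^sup>2 + r\<^sup>2 - 1 + Re ((2 * of_real r * cnj a) * \<xi>)\<bar>" by (rule 2(4)[OF \<xi>])
      also have "(cmod a)\<^sup>2 + r\<^sup>2 - 1 + Re ((2 * of_real r * cnj a) * \<xi>) = (cmod z)\<^sup>2 - 1"
      proof -
        have "(cmod z)\<^sup>2 = (cmod a)\<^sup>2 + r\<^sup>2 * (cmod \<xi>)\<^sup>2 + Re ((2 * of_real r * cnj a) * \<xi>)"
          unfolding zx cmod_power2 by (simp add: power2_eq_square algebra_simps)
        then show ?thesis using \<xi> by simp
      qed
      finally have B: "c2 * (h * h) \<le> \<bar>(cmod z)\<^sup>2 - 1\<bar>" .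
      have "c / real N ^ 4 = (c1 * (h * h)) * (c2 * (h * h))"
        by (simp add: c_def h_def power4_eq_xxxx)
      also have "\<dots> \<le> \<bar>Im z\<bar> * \<bar>(cmod z)\<^sup>2 - 1\<bar>"
        using A B 1 2 h0 by (intro mult_mono) auto
      finally show "c / real N ^ 4 \<le> \<bar>critical z\<bar>" by (simp add: critical_def abs_mult)
    qed
  qed
qed

section \<open>From logarithmic potentials to weak convergence\<close>

lemma tendsto_sum_mset_zero:
  fixes f :: "'a \<Rightarrow> 'b \<Rightarrow> real"
  assumes "\<And>w. w \<in># Z \<Longrightarrow> (f w \<longlongrightarrow> 0) F"
  shows "((\<lambda>n. \<Sum>w\<in>#Z. f w n) \<longlongrightarrow> 0) F"
  using assms by (induction Z) (auto intro!: tendsto_add_zero)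

lemma mset_mean_sum_mset:
  "mset_mean (\<lambda>x. \<Sum>w\<in>#Z. f w x) X = (\<Sum>w\<in>#Z. mset_mean (f w) X)"
  by (induction Z) (simp_all add: mset_mean_add, simp add: mset_mean_def)

lemma mset_mean_divide: "mset_mean (\<lambda>x. f x / c) X = mset_mean f X / c"
proof -
  have "(\<Sum>x\<in>#X. f x / c) = (\<Sum>x\<in>#X. f x) / c"
    by (induction X) (auto simp: add_divide_distrib)
  then show ?thesis by (simp add: mset_mean_def)
qed

lemma ln_cmod_prod_mset:
  assumes "\<And>w. w \<in># Z \<Longrightarrow> x \<noteq> w"
  shows "ln (cmod (\<Prod>w\<in>#Z. x - w)) = (\<Sum>w\<in>#Z. ln (cmod (w - x))) \<and> (\<Prod>w\<in>#Z. x - w) \<noteq> 0"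
  using assms by (induction Z) (auto simp: norm_mult ln_mult norm_minus_commute)

lemma critical_lipschitz:
  assumes "cmod z \<le> R" "cmod w \<le> R"
  shows "\<bar>critical z - critical w\<bar> \<le> (3 * R\<^sup>2 + 1) * cmod (z - w)"
proof -
  have R: "0 \<le> R" using assms(1) norm_ge_zero order_trans by blast
  have 1: "\<bar>(cmod z)\<^sup>2 - 1\<bar> \<le> R\<^sup>2 + 1"
    using power_mono[OF assms(1), of 2] zero_le_power2[of "cmod z"] by (auto simp: abs_le_iff)
  have 2: "\<bar>(cmod z)\<^sup>2 - (cmod w)\<^sup>2\<bar> \<le> (2 * R) * cmod (z - w)"
  proof -
    have "(cmod z)\<^sup>2 - (cmod w)\<^sup>2 = (cmod z + cmod w) * (cmod z - cmod w)"
      by (simp add: power2_eq_square algebra_simps)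
    then have "\<bar>(cmod z)\<^sup>2 - (cmod w)\<^sup>2\<bar> = (cmod z + cmod w) * \<bar>cmod z - cmod w\<bar>"
      by (simp add: abs_mult)
    also have "\<dots> \<le> (2 * R) * cmod (z - w)"
      using assms R norm_triangle_ineq3[of z w] by (intro mult_mono) auto
    finally show ?thesis .
  qed
  have "critical z - critical w = Im (z - w) * ((cmod z)\<^sup>2 - 1) + Im w * ((cmod z)\<^sup>2 - (cmod w)\<^sup>2)"
    by (simp add: critical_def algebra_simps)
  also have "\<bar>\<dots>\<bar> \<le> \<bar>Im (z - w)\<bar> * \<bar>(cmod z)\<^sup>2 - 1\<bar> + \<bar>Im w\<bar> * \<bar>(cmod z)\<^sup>2 - (cmod w)\<^sup>2\<bar>"
    by (metis abs_mult abs_triangle_ineq)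
  also have "\<dots> \<le> cmod (z - w) * (R\<^sup>2 + 1) + R * ((2 * R) * cmod (z - w))"
    using abs_Im_le_cmod[of "z - w"] abs_Im_le_cmod[of w] assms 1 2 R
    by (intro add_mono mult_mono) (auto intro: order_trans)
  also have "\<dots> = (3 * R\<^sup>2 + 1) * cmod (z - w)"
    by (simp add: power2_eq_square algebra_simps)
  finally show ?thesis .
qed

text \<open>Potentials are compared at \<open>N\<close> points of the circle away from the critical set. The points of
\<open>X n\<close> and \<open>Y n\<close> accumulate only at the critical set, so for large \<open>n\<close> they stay away from these \<open>N\<close> points
and the discrete form of Jensen's formula applies to them. Its error is uniform in \<open>n\<close> and tends to \<open>0\<close>
as \<open>N\<close> grows, so a suitable \<open>N\<close> can be fixed before \<open>n\<close> tends to infinity.\<close>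

lemma mset_mean_ln_max_diff_tendsto_0:
  fixes X Y :: "nat \<Rightarrow> complex multiset" and \<epsilon> :: "nat \<Rightarrow> real"
  assumes pot: "\<And>z. critical z \<noteq> 0 \<Longrightarrow>
      (\<lambda>n. mset_mean (\<lambda>x. ln (cmod (z - x))) (X n) - mset_mean (\<lambda>x. ln (cmod (z - x))) (Y n)) \<longlonglongrightarrow> 0"
    and eps: "\<epsilon> \<longlonglongrightarrow> 0"
    and locX: "eventually (\<lambda>n. \<forall>x\<in>#X n. \<bar>critical x\<bar> \<le> cmod x * \<epsilon> n) sequentially"
    and locY: "eventually (\<lambda>n. \<forall>x\<in>#Y n. \<bar>critical x\<bar> \<le> cmod x * \<epsilon> n) sequentially"
    and r: "0 < r" "r \<noteq> 1"
  shows "(\<lambda>n. mset_mean (\<lambda>x. ln (max r (cmod (x - a)))) (X n)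
      - mset_mean (\<lambda>x. ln (max r (cmod (x - a)))) (Y n)) \<longlonglongrightarrow> 0"
proof (rule LIMSEQ_I)
  fix \<eta> :: real assume \<eta>: "0 < \<eta>"
  let ?L = "\<lambda>x. ln (max r (cmod (x - a)))"
  obtain c where c: "0 < c" and pts: "\<And>N. 1 \<le> N \<Longrightarrow> \<exists>\<tau>. cmod \<tau> = 1 \<and>
      (\<forall>z. (z - a) ^ N = of_real r ^ N * \<tau> \<longrightarrow> c / real N ^ 4 \<le> \<bar>critical z\<bar>)"
    using circle_points_off_critical[OF r] by blast
  define R where "R = cmod a + r + 1"
  have R: "1 \<le> R" using r by (simp add: R_def)
  define K where "K = 3 * R\<^sup>2 + 1"
  have K: "0 < K" unfolding K_def by (intro add_nonneg_pos) auto
  \<comment> \<open>Near the circle \<open>critical\<close> is Lipschitz with constant \<open>K\<close>, so at distance less than \<open>c' / N ^ 4\<close> from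
     a point with \<open>c / N ^ 4 \<le> \<bar>critical w\<bar>\<close> at least half of this lower bound remains.\<close>
  define c' where "c' = min (min r 1) (c / (2 * K))"
  have c': "0 < c'" "c' \<le> r" "c' \<le> 1" "c' \<le> c / (2 * K)" using c K r by (auto simp: c'_def)
  define err where "err = (\<lambda>N. ln (12 * r / (c' / real N ^ 4)) / real N)"
  have "err \<longlonglongrightarrow> 0"
  proof -
    have "(\<lambda>N. ln (12 * r / c') / real N + 4 * (ln (real N) / real N)) \<longlonglongrightarrow> 0 + 4 * 0"
      by (intro tendsto_add tendsto_mult tendsto_const lim_ln_over_n lim_const_over_n)
    moreover have "eventually (\<lambda>N. ln (12 * r / c') / real N + 4 * (ln (real N) / real N) = err N) sequentially"
    proof (rule eventually_mono[OF eventually_gt_at_top[of 0]])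
      fix N :: nat assume N: "0 < N"
      have "12 * r / (c' / real N ^ 4) = (12 * r / c') * real N ^ 4" by simp
      moreover have "ln ((12 * r / c') * real N ^ 4) = ln (12 * r / c') + ln (real N ^ 4)"
        using r c' N by (intro ln_mult_pos) auto
      moreover have "ln (real N ^ 4) = 4 * ln (real N)"
        using N by (simp add: ln_realpow)
      ultimately have "ln (12 * r / (c' / real N ^ 4)) = ln (12 * r / c') + 4 * ln (real N)"
        by simp
      then show "ln (12 * r / c') / real N + 4 * (ln (real N) / real N) = err N"
        by (simp add: err_def add_divide_distrib)
    qed
    ultimately show ?thesis by (simp add: tendsto_cong)
  qed
  then have "eventually (\<lambda>N. err N < \<eta> / 3) sequentially"
    using \<eta> by (intro order_tendstoD) auto
  then have "eventually (\<lambda>N. err N < \<eta> / 3 \<and> 1 \<le> N) sequentially"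
    using eventually_ge_at_top[of "1::nat"] by eventually_elim simp
  then obtain N where N: "err N < \<eta> / 3" "1 \<le> N"
    unfolding eventually_sequentially by blast
  define \<delta> where "\<delta> = c' / real N ^ 4"
  have N4: "real N ^ 4 \<ge> 1" using N(2) by simp
  have \<delta>: "0 < \<delta>" "\<delta> \<le> r" "\<delta> \<le> 1" "\<delta> \<le> c / real N ^ 4 / (2 * K)"
  proof -
    show "0 < \<delta>" using c' N by (simp add: \<delta>_def)
    have "\<delta> \<le> c' / 1" unfolding \<delta>_def using c' N(2) N4 by (intro divide_left_mono) auto
    then show "\<delta> \<le> r" "\<delta> \<le> 1" using c' by auto
    have "\<delta> \<le> (c / (2 * K)) / real N ^ 4" unfolding \<delta>_def using c' N4 by (intro divide_right_mono) auto
    then show "\<delta> \<le> c / real N ^ 4 / (2 * K)" by (simp add: mult.commute)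
  qed
  obtain \<tau> where \<tau>: "cmod \<tau> = 1"
    "\<And>z. (z - a) ^ N = of_real r ^ N * \<tau> \<Longrightarrow> c / real N ^ 4 \<le> \<bar>critical z\<bar>"
    using pts[OF N(2)] by blast
  obtain Z where Z: "size Z = N" "\<And>z. (\<Prod>w\<in>#Z. z - w) = (z - a) ^ N - of_real r ^ N * \<tau>"
    using circle_points_exist[OF N(2)] by blast
  have Zroot: "(w - a) ^ N = of_real r ^ N * \<tau>" if "w \<in># Z" for w
  proof -
    have "(\<Prod>u\<in>#Z. w - u) = 0" using that by (auto simp: prod_mset_zero_iff)
    then show ?thesis using Z(2)[of w] by simp
  qed
  have on_circle: "cmod (w - a) = r" if w: "(w - a) ^ N = of_real r ^ N * \<tau>" for w
  proof -
    have "cmod (w - a) ^ N = r ^ N"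
      using arg_cong[OF w, of cmod] r \<tau>(1) by (simp add: norm_power norm_mult)
    then show ?thesis using power_eq_imp_eq_base[of "cmod (w - a)" N r] N(2) r by simp
  qed
  define S where "S = (\<lambda>x. (\<Sum>w\<in>#Z. ln (cmod (w - x))) / real N)"
  have approx: "\<bar>S x - ?L x\<bar> \<le> err N" if loc: "\<bar>critical x\<bar> \<le> cmod x * e" and e: "\<bar>e\<bar> < c / real N ^ 4 / (2 * R)" for x e
  proof -
    \<comment> \<open>A point close to \<open>w\<close> would have a value of \<open>critical\<close> incompatible with the localization.\<close>
    have far: "\<delta> \<le> cmod (x - w)" if w: "(w - a) ^ N = of_real r ^ N * \<tau>" for w
    proof (rule ccontr)
      assume "\<not> ?thesis"
      then have near: "cmod (x - w) < \<delta>" by simp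
      have wR: "cmod w \<le> R" using on_circle[OF w] norm_triangle_ineq2[of w a] by (simp add: R_def)
      have xR: "cmod x \<le> R"
        using on_circle[OF w] norm_triangle_ineq[of "x - w" "w - a"] norm_triangle_ineq2[of x a] near \<delta>(3)
        by (simp add: R_def)
      have "c / real N ^ 4 \<le> \<bar>critical w\<bar>" by (rule \<tau>(2)[OF w])
      also have "\<dots> \<le> \<bar>critical x\<bar> + \<bar>critical w - critical x\<bar>" by linarith
      also have "\<bar>critical w - critical x\<bar> \<le> K * cmod (w - x)"
        unfolding K_def by (rule critical_lipschitz[OF wR xR])
      also have "K * cmod (w - x) < K * \<delta>" using near K by (simp add: norm_minus_commute)
      also have "K * \<delta> \<le> K * (c / real N ^ 4 / (2 * K))" using \<delta>(4) K by (intro mult_left_mono) auto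
      also have "\<dots> = c / real N ^ 4 / 2" using K by simp
      finally have "c / real N ^ 4 / 2 < \<bar>critical x\<bar>" by simp
      also have "\<dots> \<le> cmod x * \<bar>e\<bar>" using loc by (meson abs_ge_self mult_left_mono norm_ge_zero order_trans)
      also have "\<dots> \<le> R * (c / real N ^ 4 / (2 * R))" using xR e R by (intro mult_mono) auto
      also have "\<dots> = c / real N ^ 4 / 2" using R by simp
      finally show False by simp
    qed
    have "x \<noteq> w" if "w \<in># Z" for w using far[OF Zroot[OF that]] \<delta>(1) by auto
    then have "ln (cmod ((x - a) ^ N - of_real r ^ N * \<tau>)) = (\<Sum>w\<in>#Z. ln (cmod (w - x)))"
      using ln_cmod_prod_mset[of Z x] Z(2)[of x] by simp
    moreover have "\<bar>ln (cmod ((x - a) ^ N - of_real r ^ N * \<tau>)) - real N * ?L x\<bar> \<le> ln (12 * r / \<delta>)"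
      by (rule ln_circle_product_approx[OF N(2) r(1) \<tau>(1) \<delta>(1,2)]) (rule far)
    ultimately have "\<bar>(\<Sum>w\<in>#Z. ln (cmod (w - x))) - real N * ?L x\<bar> \<le> ln (12 * r / \<delta>)" by simp
    then have "\<bar>(\<Sum>w\<in>#Z. ln (cmod (w - x))) - real N * ?L x\<bar> / real N \<le> err N"
      unfolding err_def \<delta>_def by (intro divide_right_mono) auto
    also have "\<bar>(\<Sum>w\<in>#Z. ln (cmod (w - x))) - real N * ?L x\<bar> / real N
        = \<bar>((\<Sum>w\<in>#Z. ln (cmod (w - x))) - real N * ?L x) / real N\<bar>" by (simp add: abs_divide)
    also have "((\<Sum>w\<in>#Z. ln (cmod (w - x))) - real N * ?L x) / real N = S x - ?L x"
      using N(2) by (simp add: S_def diff_divide_distrib)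
    finally show ?thesis .
  qed
  have "(\<lambda>n. mset_mean S (X n) - mset_mean S (Y n)) \<longlonglongrightarrow> 0"
  proof -
    have "(\<lambda>n. (\<Sum>w\<in>#Z. mset_mean (\<lambda>x. ln (cmod (w - x))) (X n) - mset_mean (\<lambda>x. ln (cmod (w - x))) (Y n)) / real N) \<longlonglongrightarrow> 0 / real N"
    proof (intro tendsto_divide tendsto_const tendsto_sum_mset_zero pot)
      fix w assume w: "w \<in># Z"
      have "0 < c / real N ^ 4" using c N(2) by simp
      then show "critical w \<noteq> 0" using \<tau>(2)[OF Zroot[OF w]] by auto
    qed (use N(2) in auto)
    moreover have "(\<Sum>w\<in>#Z. f w - g w) = (\<Sum>w\<in>#Z. f w) - (\<Sum>w\<in>#Z. g w)" for f g :: "complex \<Rightarrow> real"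
      by (induction Z) auto
    ultimately show ?thesis
      by (simp add: S_def mset_mean_divide mset_mean_sum_mset diff_divide_distrib)
  qed
  then have "eventually (\<lambda>n. \<bar>mset_mean S (X n) - mset_mean S (Y n)\<bar> < \<eta> / 3) sequentially"
    using \<eta> by (auto simp: tendsto_iff dist_real_def dest!: spec[of _ "\<eta> / 3"])
  moreover have "eventually (\<lambda>n. \<bar>\<epsilon> n\<bar> < c / real N ^ 4 / (2 * R)) sequentially"
  proof -
    have "0 < c / real N ^ 4 / (2 * R)" using c N(2) R by simp
    from tendstoD[OF eps this] show ?thesis by (simp add: dist_real_def)
  qed
  ultimately have "eventually (\<lambda>n. norm (mset_mean ?L (X n) - mset_mean ?L (Y n) - 0) < \<eta>) sequentially"
    using locX locY
  proof eventually_elim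
    case (elim n)
    have e0: "0 \<le> err N"
    proof -
      have "12 * r / \<delta> \<ge> 1" using \<delta> r by (simp add: field_simps)
      then show ?thesis by (simp add: err_def \<delta>_def)
    qed
    have "\<bar>mset_mean S (X n) - mset_mean ?L (X n)\<bar> \<le> err N" "\<bar>mset_mean S (Y n) - mset_mean ?L (Y n)\<bar> \<le> err N"
      using elim approx e0 by (auto intro!: abs_mset_mean_diff_le)
    then show ?case using elim(1) N(1) unfolding real_norm_def by linarith
  qed
  then show "\<exists>n0. \<forall>n\<ge>n0. norm (mset_mean ?L (X n) - mset_mean ?L (Y n) - 0) < \<eta>"
    by (simp add: eventually_sequentially)
qed

text \<open>A compactly supported radial function that is a difference of two functions \<open>ln (max r (cmod z))\<close>, hence
accessible through logarithmic potentials.\<close>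

definition log_bump :: "real \<Rightarrow> complex \<Rightarrow> real" where
  "log_bump r z = ln (max (2 * r) (cmod z)) - ln (max r (cmod z))"

lemma log_bump_bounds:
  assumes "0 < r"
  shows "0 \<le> log_bump r z" "log_bump r z \<le> ln 2"
proof -
  show "0 \<le> log_bump r z" unfolding log_bump_def using assms by (auto intro!: ln_mono)
  have "ln (max (2 * r) (cmod z)) \<le> ln (2 * max r (cmod z))"
    using assms by (intro ln_mono) auto
  also have "\<dots> = ln 2 + ln (max r (cmod z))" using assms by (subst ln_mult_pos) auto
  finally show "log_bump r z \<le> ln 2" by (simp add: log_bump_def)
qed

lemma log_bump_outside: "2 * r \<le> cmod z \<Longrightarrow> 0 < r \<Longrightarrow> log_bump r z = 0"
  by (simp add: log_bump_def max_def)

lemma log_bump_inside: "cmod z \<le> r \<Longrightarrow> 0 < r \<Longrightarrow> log_bump r z = ln 2"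
  by (simp add: log_bump_def max_def ln_mult)

lemma log_bump_minus: "log_bump r (- z) = log_bump r z"
  by (simp add: log_bump_def)

lemma continuous_on_log_bump [continuous_intros]:
  "0 < r \<Longrightarrow> continuous_on A g \<Longrightarrow> continuous_on A (\<lambda>z. log_bump r (g z))"
  unfolding log_bump_def by (intro continuous_intros) auto

lemma log_bump_measurable [measurable]: "0 < r \<Longrightarrow> log_bump r \<in> borel_measurable borel"
  by (intro borel_measurable_continuous_onI continuous_intros)

lemma integrable_continuous_support:
  fixes f :: "complex \<Rightarrow> real"
  assumes "continuous_on UNIV f" "\<And>z. R < cmod z \<Longrightarrow> f z = 0"
  shows "integrable lborel f"
proof -
  have "integrable lborel (\<lambda>x. indicator (cball 0 R) x *\<^sub>R f x)"
    by (rule borel_integrable_compact) (auto intro: continuous_on_subset[OF assms(1)])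
  also have "(\<lambda>x. indicator (cball 0 R) x *\<^sub>R f x) = f"
    using assms(2) by (auto simp: indicator_def fun_eq_iff not_le)
  finally show ?thesis .
qed

lemma integrable_log_bump: "0 < r \<Longrightarrow> integrable lborel (log_bump r)"
  by (rule integrable_continuous_support[of _ "2 * r"])
     (auto intro!: continuous_intros log_bump_outside)

lemma integral_log_bump_pos:
  assumes r: "0 < r"
  shows "0 < integral\<^sup>L lborel (log_bump r)"
proof -
  have "0 < ln 2 * measure lborel (ball (0::complex) r)"
    using content_ball_pos[of r "0::complex"] r by simp
  also have "\<dots> = integral\<^sup>L lborel (\<lambda>z::complex. ln 2 * indicator (ball 0 r) z)"
    by simp
  also have "\<dots> \<le> integral\<^sup>L lborel (log_bump r)"
  proof (rule integral_mono)
    have "integrable lborel (indicator (ball (0::complex) r) :: complex \<Rightarrow> real)"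
      by (rule integrable_real_indicator) (use emeasure_bounded_finite[OF bounded_ball, of "0::complex" r] in auto)
    then show "integrable lborel (\<lambda>z::complex. ln 2 * indicator (ball 0 r) z :: real)"
      by (rule integrable_mult_right)
    show "integrable lborel (log_bump r)" by (rule integrable_log_bump[OF r])
    fix z :: complex
    show "ln 2 * indicator (ball 0 r) z \<le> log_bump r z"
      using log_bump_inside[of z r] log_bump_bounds[OF r, of z] r by (auto simp: indicator_def)
  qed
  finally show ?thesis .
qed

lemma integral_log_bump_shift:
  assumes r: "0 < r"
  shows "(\<integral>a. log_bump r (x - a) \<partial>lborel) = integral\<^sup>L lborel (log_bump r)"
    and "integrable lborel (\<lambda>a. log_bump r (x - a))"
proof -
  have eq: "log_bump r (x - a) = log_bump r (- x + a)" for a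
    using log_bump_minus[of r "x - a"] by (simp add: algebra_simps)
  have "(\<integral>a. log_bump r (- x + a) \<partial>lborel) = integral\<^sup>L (distr lborel borel ((+) (- x))) (log_bump r)"
    using r by (subst integral_distr) auto
  then show "(\<integral>a. log_bump r (x - a) \<partial>lborel) = integral\<^sup>L lborel (log_bump r)"
    by (simp add: eq lborel_distr_plus)
  have "integrable (distr lborel borel ((+) (- x))) (log_bump r)"
    using integrable_log_bump[OF r] by (simp add: lborel_distr_plus)
  then show "integrable lborel (\<lambda>a. log_bump r (x - a))"
    using r by (subst (asm) integrable_distr_eq) (auto simp: eq)
qed

lemma integral_sum_mset:
  fixes g :: "'a \<Rightarrow> 'b \<Rightarrow> real"
  assumes "\<And>x. x \<in># X \<Longrightarrow> integrable M (g x)"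
  shows "(\<integral>a. (\<Sum>x\<in>#X. g x a) \<partial>M) = (\<Sum>x\<in>#X. integral\<^sup>L M (g x)) \<and> integrable M (\<lambda>a. \<Sum>x\<in>#X. g x a)"
  using assms by (induction X) auto

text \<open>The convolution \<open>g\<close> of \<open>f\<close> with a normalized narrow bump is uniformly close to \<open>f\<close>. The difference of the
means of \<open>g\<close> is an integral over the centre \<open>a\<close> of the bump of differences that tend to \<open>0\<close> for each \<open>a\<close>, so
dominated convergence applies.\<close>

lemma mset_mean_compact_support_diff_tendsto_0:
  fixes X Y :: "nat \<Rightarrow> complex multiset" and f :: "complex \<Rightarrow> real"
  assumes bump: "\<And>r a. 0 < r \<Longrightarrow> r < 1 / 2 \<Longrightarrow>
      (\<lambda>n. mset_mean (\<lambda>x. log_bump r (x - a)) (X n) - mset_mean (\<lambda>x. log_bump r (x - a)) (Y n)) \<longlonglongrightarrow> 0"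
    and f: "continuous_on UNIV f" and supp: "\<And>z. R < cmod z \<Longrightarrow> f z = 0"
  shows "(\<lambda>n. mset_mean f (X n) - mset_mean f (Y n)) \<longlonglongrightarrow> 0"
proof (rule LIMSEQ_I)
  fix \<eta> :: real assume \<eta>: "0 < \<eta>"
  have unif: "uniformly_continuous_on (cball 0 (R + 1)) f"
    by (intro compact_uniformly_continuous continuous_on_subset[OF f]) auto
  obtain d where d: "0 < d" "\<And>x y. cmod x \<le> R + 1 \<Longrightarrow> cmod y \<le> R + 1 \<Longrightarrow> cmod (y - x) < d \<Longrightarrow> \<bar>f y - f x\<bar> < \<eta> / 3"
    using unif[unfolded uniformly_continuous_on_def, rule_format, of "\<eta> / 3"] \<eta>
    by (auto simp: dist_norm)
  define r where "r = min (d / 2) (1 / 4)"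
  have r: "0 < r" "r < 1 / 2" "2 * r \<le> d" "2 * r \<le> 1" using d(1) by (auto simp: r_def)
  define c where "c = integral\<^sup>L lborel (log_bump r)"
  have c: "0 < c" unfolding c_def by (rule integral_log_bump_pos[OF r(1)])
  have fint: "integrable lborel f" by (rule integrable_continuous_support[OF f supp])
  have close: "\<bar>f a - f x\<bar> \<le> \<eta> / 3" if "cmod (x - a) < 2 * r" for a x
  proof (cases "cmod x \<le> R + 1 \<and> cmod a \<le> R + 1")
    case True
    then show ?thesis using d(2)[of x a] that r(3) by (simp add: norm_minus_commute)
  next
    case False
    then have "R < cmod x" "R < cmod a"
      using that r(4) norm_triangle_ineq2[of x a] norm_triangle_ineq2[of a x] by (auto simp: norm_minus_commute)
    then show ?thesis using supp \<eta> by simp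
  qed
  define g where "g = (\<lambda>x. (\<integral>a. f a * log_bump r (x - a) \<partial>lborel) / c)"
  have prodint: "integrable lborel (\<lambda>a. f a * log_bump r (x - a))" for x
    by (rule integrable_continuous_support[of _ R])
       (use r(1) f supp in \<open>auto intro!: continuous_intros\<close>)
  have gf: "\<bar>g x - f x\<bar> \<le> \<eta> / 3" for x
  proof -
    have "c * (g x - f x) = (\<integral>a. f a * log_bump r (x - a) \<partial>lborel) - f x * (\<integral>a. log_bump r (x - a) \<partial>lborel)"
      using c by (simp add: g_def integral_log_bump_shift(1)[OF r(1)] c_def[symmetric] right_diff_distrib)
    also have "\<dots> = (\<integral>a. f a * log_bump r (x - a) - f x * log_bump r (x - a) \<partial>lborel)"
      using prodint integral_log_bump_shift(2)[OF r(1)] by simp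
    also have "\<bar>\<dots>\<bar> \<le> (\<integral>a. (\<eta> / 3) * log_bump r (x - a) \<partial>lborel)"
    proof (rule order_trans[OF integral_abs_bound], rule integral_mono)
      show "integrable lborel (\<lambda>a. \<bar>f a * log_bump r (x - a) - f x * log_bump r (x - a)\<bar>)"
        using prodint integral_log_bump_shift(2)[OF r(1)] by auto
      show "integrable lborel (\<lambda>a. (\<eta> / 3) * log_bump r (x - a))"
        using integral_log_bump_shift(2)[OF r(1)] by auto
      fix a
      have "\<bar>f a * log_bump r (x - a) - f x * log_bump r (x - a)\<bar> = \<bar>f a - f x\<bar> * log_bump r (x - a)"
        using log_bump_bounds(1)[OF r(1)] by (simp add: left_diff_distrib[symmetric] abs_mult)
      also have "\<dots> \<le> (\<eta> / 3) * log_bump r (x - a)"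
      proof (cases "cmod (x - a) < 2 * r")
        case True
        then show ?thesis
          by (rule mult_right_mono[OF close log_bump_bounds(1)[OF r(1)]])
      next
        case False
        then show ?thesis using log_bump_outside[of r "x - a"] r(1) by simp
      qed
      finally show "\<bar>f a * log_bump r (x - a) - f x * log_bump r (x - a)\<bar> \<le> (\<eta> / 3) * log_bump r (x - a)" .
    qed
    also have "\<dots> = c * (\<eta> / 3)" by (simp add: integral_log_bump_shift(1)[OF r(1)] c_def)
    finally have "c * \<bar>g x - f x\<bar> \<le> c * (\<eta> / 3)" using c by (simp add: abs_mult)
    then show ?thesis using c by simp
  qed
  define D where "D = (\<lambda>n a. mset_mean (\<lambda>x. log_bump r (x - a)) (X n) - mset_mean (\<lambda>x. log_bump r (x - a)) (Y n))"
  have meang: "mset_mean g Z = (\<integral>a. f a * mset_mean (\<lambda>x. log_bump r (x - a)) Z \<partial>lborel) / c"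
    and meang_int: "integrable lborel (\<lambda>a. f a * mset_mean (\<lambda>x. log_bump r (x - a)) Z)" for Z
  proof -
    have eq: "f a * mset_mean (\<lambda>x. log_bump r (x - a)) Z = (\<Sum>x\<in>#Z. f a * log_bump r (x - a)) / real (size Z)" for a
      by (simp add: mset_mean_def sum_mset_distrib_left image_mset.compositionality comp_def)
    note I = integral_sum_mset[of Z lborel "\<lambda>x a. f a * log_bump r (x - a)", OF prodint]
    have "(\<Sum>x\<in>#Z. g x) = (\<Sum>x\<in>#Z. (\<integral>a. f a * log_bump r (x - a) \<partial>lborel)) / c"
      unfolding g_def by (induction Z) (auto simp: add_divide_distrib)
    then show "mset_mean g Z = (\<integral>a. f a * mset_mean (\<lambda>x. log_bump r (x - a)) Z \<partial>lborel) / c"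
      unfolding eq using I by (simp add: mset_mean_def)
    show "integrable lborel (\<lambda>a. f a * mset_mean (\<lambda>x. log_bump r (x - a)) Z)"
      unfolding eq using I by auto
  qed
  have D: "mset_mean g (X n) - mset_mean g (Y n) = (\<integral>a. f a * D n a \<partial>lborel) / c" for n
    unfolding meang D_def right_diff_distrib using meang_int by (simp add: diff_divide_distrib)
  have Dbound: "\<bar>D n a\<bar> \<le> 2 * ln 2" for n a
  proof -
    have "\<bar>mset_mean (\<lambda>x. log_bump r (x - a)) Z - mset_mean (\<lambda>x. 0) Z\<bar> \<le> ln 2" for Z
      by (rule abs_mset_mean_diff_le) (use log_bump_bounds[OF r(1)] in auto)
    moreover have "mset_mean (\<lambda>x::complex. 0) Z = 0" for Z by (simp add: mset_mean_def)
    ultimately have "\<bar>mset_mean (\<lambda>x. log_bump r (x - a)) Z\<bar> \<le> ln 2" for Z by simp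
    from this[of "X n"] this[of "Y n"] show ?thesis
      unfolding D_def by linarith
  qed
  have "(\<lambda>n. \<integral>a. f a * D n a \<partial>lborel) \<longlonglongrightarrow> (\<integral>a. 0 \<partial>(lborel :: complex measure))"
  proof (rule integral_dominated_convergence[where w="\<lambda>a. \<bar>f a\<bar> * (2 * ln 2)"])
    show "(\<lambda>a. f a * D n a) \<in> borel_measurable lborel" for n
      unfolding D_def right_diff_distrib using meang_int by (intro borel_measurable_integrable) auto
    show "integrable lborel (\<lambda>a. \<bar>f a\<bar> * (2 * ln 2))" using fint by auto
    show "AE a in lborel. (\<lambda>n. f a * D n a) \<longlonglongrightarrow> 0"
      using bump[OF r(1,2)] by (intro AE_I2 tendsto_mult_right_zero) (auto simp: D_def)
    show "AE a in lborel. norm (f a * D n a) \<le> \<bar>f a\<bar> * (2 * ln 2)" for n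
      using Dbound by (intro AE_I2) (auto simp: abs_mult intro!: mult_left_mono)
  qed auto
  then have "(\<lambda>n. mset_mean g (X n) - mset_mean g (Y n)) \<longlonglongrightarrow> 0 / c"
    unfolding D using c by (intro tendsto_divide) auto
  then have "eventually (\<lambda>n. \<bar>mset_mean g (X n) - mset_mean g (Y n)\<bar> < \<eta> / 3) sequentially"
    using \<eta> by (auto simp: tendsto_iff dist_real_def dest!: spec[of _ "\<eta> / 3"])
  then have "eventually (\<lambda>n. norm (mset_mean f (X n) - mset_mean f (Y n) - 0) < \<eta>) sequentially"
  proof eventually_elim
    case (elim n)
    have "\<bar>mset_mean g Z - mset_mean f Z\<bar> \<le> \<eta> / 3" for Z
      by (rule abs_mset_mean_diff_le) (use gf \<eta> in auto)
    from this[of "X n"] this[of "Y n"] elim show ?case unfolding real_norm_def by linarith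
  qed
  then show "\<exists>n0. \<forall>n\<ge>n0. norm (mset_mean f (X n) - mset_mean f (Y n) - 0) < \<eta>"
    by (simp add: eventually_sequentially)
qed

text \<open>Tightness of \<open>Y\<close> suffices: a cutoff function that captures most of \<open>Y n\<close> has compact support, so it also
captures most of \<open>X n\<close>.\<close>

lemma mset_mean_diff_tendsto_0_of_tight:
  fixes X Y :: "nat \<Rightarrow> complex multiset" and f :: "complex \<Rightarrow> real"
  assumes vague: "\<And>f R. continuous_on UNIV f \<Longrightarrow> (\<And>z. R < cmod z \<Longrightarrow> f z = 0) \<Longrightarrow>
      (\<lambda>n. mset_mean f (X n) - mset_mean f (Y n)) \<longlonglongrightarrow> 0"
    and neX: "eventually (\<lambda>n. X n \<noteq> {#}) sequentially"
    and neY: "eventually (\<lambda>n. Y n \<noteq> {#}) sequentially"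
    and tight: "\<And>\<eta>. 0 < \<eta> \<Longrightarrow> \<exists>R. eventually (\<lambda>n.
      real (size {#x \<in># Y n. R < cmod x#}) \<le> \<eta> * real (size (Y n))) sequentially"
    and f: "continuous_on UNIV f" "bounded (range f)"
  shows "(\<lambda>n. mset_mean f (X n) - mset_mean f (Y n)) \<longlonglongrightarrow> 0"
proof (rule LIMSEQ_I)
  fix \<eta> :: real assume \<eta>: "0 < \<eta>"
  obtain C where C: "0 < C" "\<And>z. \<bar>f z\<bar> \<le> C"
    using f(2) unfolding bounded_pos by auto
  define \<kappa> where "\<kappa> = \<eta> / (4 * C)"
  have \<kappa>: "0 < \<kappa>" "C * \<kappa> = \<eta> / 4" using C \<eta> by (auto simp: \<kappa>_def)
  obtain R where R: "eventually (\<lambda>n. real (size {#x \<in># Y n. R < cmod x#}) \<le> \<kappa> * real (size (Y n))) sequentially"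
    using tight[OF \<kappa>(1)] by blast
  define cut where "cut = (\<lambda>z. max 0 (min 1 (R + 1 - cmod z)))"
  have cutc: "continuous_on UNIV cut" unfolding cut_def by (intro continuous_intros)
  have cut: "0 \<le> cut z" "cut z \<le> 1" "R + 1 < cmod z \<Longrightarrow> cut z = 0" "cmod z \<le> R \<Longrightarrow> cut z = 1" for z
    by (auto simp: cut_def)
  have "(\<lambda>n. mset_mean cut (X n) - mset_mean cut (Y n)) \<longlonglongrightarrow> 0"
    by (rule vague[OF cutc cut(3)])
  then have "eventually (\<lambda>n. \<bar>mset_mean cut (X n) - mset_mean cut (Y n)\<bar> < \<kappa>) sequentially"
    using \<kappa> by (auto simp: tendsto_iff dist_real_def dest!: spec[of _ \<kappa>])
  moreover have "(\<lambda>n. mset_mean (\<lambda>z. f z * cut z) (X n) - mset_mean (\<lambda>z. f z * cut z) (Y n)) \<longlonglongrightarrow> 0"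
    by (rule vague[of _ "R + 1"]) (use cut(3) in \<open>auto intro!: continuous_intros f(1) cutc\<close>)
  then have "eventually (\<lambda>n. \<bar>mset_mean (\<lambda>z. f z * cut z) (X n) - mset_mean (\<lambda>z. f z * cut z) (Y n)\<bar> < \<eta> / 4) sequentially"
    using \<eta> by (auto simp: tendsto_iff dist_real_def dest!: spec[of _ "\<eta> / 4"])
  ultimately have "eventually (\<lambda>n. norm (mset_mean f (X n) - mset_mean f (Y n) - 0) < \<eta>) sequentially"
    using R neX neY
  proof eventually_elim
    case (elim n)
    have tail: "\<bar>mset_mean f Z - mset_mean (\<lambda>z. f z * cut z) Z\<bar> \<le> C * (1 - mset_mean cut Z)" if "Z \<noteq> {#}" for Z
    proof -
      have eq: "C * (1 - mset_mean cut Z) = mset_mean (\<lambda>z. C * (1 - cut z)) Z"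
      proof -
        have "mset_mean (\<lambda>z. C * (1 - cut z)) Z = C * mset_mean (\<lambda>z. 1 - cut z) Z"
          by (simp add: mset_mean_def sum_mset_distrib_left image_mset.compositionality comp_def)
        also have "mset_mean (\<lambda>z. 1 - cut z) Z = 1 - mset_mean cut Z"
          using that by (simp add: mset_mean_diff mset_mean_const)
        finally show ?thesis ..
      qed
      have pt: "\<bar>f z - f z * cut z\<bar> \<le> C * (1 - cut z)" for z
      proof -
        have "\<bar>f z - f z * cut z\<bar> = \<bar>f z\<bar> * (1 - cut z)"
          using cut(2)[of z] by (metis abs_mult abs_of_nonneg diff_ge_0_iff_ge mult_1_right right_diff_distrib)
        also have "\<dots> \<le> C * (1 - cut z)" using C cut(2)[of z] by (intro mult_right_mono) auto
        finally show ?thesis .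
      qed
      have "mset_mean (\<lambda>z. f z - f z * cut z) Z \<le> mset_mean (\<lambda>z. C * (1 - cut z)) Z"
        using pt by (intro mset_mean_mono) (force simp: abs_le_iff)
      moreover have "mset_mean (\<lambda>z. f z * cut z - f z) Z \<le> mset_mean (\<lambda>z. C * (1 - cut z)) Z"
        using pt by (intro mset_mean_mono) (force simp: abs_le_iff)
      ultimately show ?thesis unfolding eq by (simp add: mset_mean_diff abs_le_iff)
    qed
    have "1 - mset_mean cut (Y n) \<le> \<kappa>"
    proof -
      have "1 - mset_mean cut (Y n) = mset_mean (\<lambda>z. 1 - cut z) (Y n)"
        using elim by (simp add: mset_mean_diff mset_mean_const)
      also have "\<dots> \<le> mset_mean (\<lambda>z. if R < cmod z then 1 else 0) (Y n)"
        by (rule mset_mean_mono) (use cut in \<open>auto simp: not_less\<close>)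
      also have "\<dots> = real (size {#x \<in># Y n. R < cmod x#}) / real (size (Y n))"
      proof -
        have "(\<Sum>z\<in>#Z. if R < cmod z then 1 else 0) = real (size {#x \<in># Z. R < cmod x#})" for Z
          by (induction Z) auto
        then show ?thesis by (simp add: mset_mean_def)
      qed
      also have "\<dots> \<le> \<kappa>" using elim by (simp add: divide_le_eq size_eq_0_iff_empty nonempty_has_size)
      finally show ?thesis .
    qed
    then have "C * (1 - mset_mean cut (Y n)) \<le> C * \<kappa>" "C * (1 - mset_mean cut (X n)) \<le> C * (2 * \<kappa>)"
      using C elim(1) by (auto intro!: mult_left_mono)
    then have "C * (1 - mset_mean cut (Y n)) \<le> \<eta> / 4" "C * (1 - mset_mean cut (X n)) \<le> 2 * (\<eta> / 4)"
      using \<kappa>(2) by (auto simp: mult.left_commute)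
    then show ?case
      using tail[OF elim(4)] tail[OF elim(5)] elim(2) unfolding real_norm_def by linarith
  qed
  then show "\<exists>n0. \<forall>n\<ge>n0. norm (mset_mean f (X n) - mset_mean f (Y n) - 0) < \<eta>"
    by (simp add: eventually_sequentially)
qed

text \<open>A replacement principle for logarithmic potentials, adapted to point sets that accumulate at the
critical set: convergence of the potentials off this null set suffices.\<close>

theorem logarithmic_replacement:
  fixes X Y :: "nat \<Rightarrow> complex multiset" and \<epsilon> :: "nat \<Rightarrow> real" and f :: "complex \<Rightarrow> real"
  assumes pot: "\<And>z. critical z \<noteq> 0 \<Longrightarrow>
      (\<lambda>n. mset_mean (\<lambda>x. ln (cmod (z - x))) (X n) - mset_mean (\<lambda>x. ln (cmod (z - x))) (Y n)) \<longlonglongrightarrow> 0"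
    and eps: "\<epsilon> \<longlonglongrightarrow> 0"
    and locX: "eventually (\<lambda>n. \<forall>x\<in>#X n. \<bar>critical x\<bar> \<le> cmod x * \<epsilon> n) sequentially"
    and locY: "eventually (\<lambda>n. \<forall>x\<in>#Y n. \<bar>critical x\<bar> \<le> cmod x * \<epsilon> n) sequentially"
    and neX: "eventually (\<lambda>n. X n \<noteq> {#}) sequentially"
    and neY: "eventually (\<lambda>n. Y n \<noteq> {#}) sequentially"
    and tight: "\<And>\<eta>. 0 < \<eta> \<Longrightarrow> \<exists>R. eventually (\<lambda>n.
      real (size {#x \<in># Y n. R < cmod x#}) \<le> \<eta> * real (size (Y n))) sequentially"
    and f: "continuous_on UNIV f" "bounded (range f)"
  shows "(\<lambda>n. mset_mean f (X n) - mset_mean f (Y n)) \<longlonglongrightarrow> 0"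
proof (rule mset_mean_diff_tendsto_0_of_tight[OF _ neX neY tight f])
  have bump: "(\<lambda>n. mset_mean (\<lambda>x. log_bump r (x - a)) (X n) - mset_mean (\<lambda>x. log_bump r (x - a)) (Y n)) \<longlonglongrightarrow> 0"
    if r: "0 < r" "r < 1 / 2" for r a
  proof -
    note L = mset_mean_ln_max_diff_tendsto_0[OF pot eps locX locY]
    have "(\<lambda>n. (mset_mean (\<lambda>x. ln (max (2 * r) (cmod (x - a)))) (X n) - mset_mean (\<lambda>x. ln (max (2 * r) (cmod (x - a)))) (Y n))
       - (mset_mean (\<lambda>x. ln (max r (cmod (x - a)))) (X n) - mset_mean (\<lambda>x. ln (max r (cmod (x - a)))) (Y n))) \<longlonglongrightarrow> 0 - 0"
      by (intro tendsto_diff L) (use r in auto)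
    then show ?thesis by (simp add: log_bump_def mset_mean_diff algebra_simps)
  qed
  fix g :: "complex \<Rightarrow> real" and R :: real
  assume g: "continuous_on UNIV g" "\<And>z. R < cmod z \<Longrightarrow> g z = 0"
  show "(\<lambda>n. mset_mean g (X n) - mset_mean g (Y n)) \<longlonglongrightarrow> 0"
    by (rule mset_mean_compact_support_diff_tendsto_0[OF bump g])
qed

section \<open>Spectral measures of companion matrices\<close>

text \<open>The non-backtracking spectrum operator with an arbitrary diagonal \<open>d\<close> in place of the degrees, scaled
by \<open>1 / s\<close>. It linearizes the quadratic pencil.\<close>

definition companion_mat :: "nat \<Rightarrow> (nat \<Rightarrow> nat \<Rightarrow> real) \<Rightarrow> (nat \<Rightarrow> real) \<Rightarrow> real \<Rightarrow> complex mat" where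
  "companion_mat n a d s = map_mat complex_of_real ((1 / s) \<cdot>\<^sub>m
     four_block_mat (Matrix.mat n n (\<lambda>(i, j). a i j))
       (1\<^sub>m n - Matrix.mat n n (\<lambda>(i, j). if i = j then d i else 0)) (1\<^sub>m n) (0\<^sub>m n n))"

lemma companion_mat_carrier: "companion_mat n a d s \<in> carrier_mat (2 * n) (2 * n)"
  unfolding companion_mat_def by (auto simp: four_block_mat_def Let_def)

lemma prod_companion_eigenvalues:
  assumes "s \<noteq> 0" "\<And>i. i < n \<Longrightarrow> of_real (e i) * t = complex_of_real ((d i - 1) / s\<^sup>2 - 1)"
  shows "(\<Prod>x\<in>#proots (char_poly (companion_mat n a d s)). z - x) = det (pencil n (\<lambda>i j. a i j / s) e t z)"
proof -
  have "lead_coeff (char_poly (companion_mat n a d s)) = 1"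
    using degree_monic_char_poly[OF companion_mat_carrier] by auto
  then have "(\<Prod>x\<in>#proots (char_poly (companion_mat n a d s)). z - x) = poly (char_poly (companion_mat n a d s)) z"
    using complex_poly_eq_prod_roots[of "char_poly (companion_mat n a d s)" z] by simp
  also have "\<dots> = det (pencil n (\<lambda>i j. a i j / s) e t z)"
    unfolding companion_mat_def by (rule poly_char_poly_companion_block) (use assms in auto)
  finally show ?thesis .
qed

lemma size_companion_eigenvalues: "size (proots (char_poly (companion_mat n a d s))) = 2 * n"
  using degree_monic_char_poly[OF companion_mat_carrier] by (auto simp: size_proots_complex)

lemma integral_esm_companion:
  fixes f :: "complex \<Rightarrow> real"
  assumes "0 < n" "continuous_on UNIV f"
  shows "integral\<^sup>L (empirical_spectral_measure (companion_mat n a d s)) f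
     = mset_mean f (proots (char_poly (companion_mat n a d s)))"
  using integral_empirical_spectral_measure[OF companion_mat_carrier _ assms(2), of n a d s] assms(1)
  by (simp add: mset_mean_def size_companion_eigenvalues)

text \<open>The deterministic core: two companion matrices whose diagonals differ by \<open>o(\<alpha>)\<close> uniformly have
asymptotically equal spectral measures. The bound on the sum of the squares provides
tightness.\<close>

theorem companion_spectra_close:
  fixes a :: "nat \<Rightarrow> nat \<Rightarrow> nat \<Rightarrow> real" and d :: "nat \<Rightarrow> nat \<Rightarrow> real" and \<alpha> :: "nat \<Rightarrow> real"
    and f :: "complex \<Rightarrow> real"
  assumes sym: "\<And>n i j. i < n \<Longrightarrow> j < n \<Longrightarrow> a n i j = a n j i"
    and pos: "eventually (\<lambda>n. 0 < \<alpha> n) sequentially"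
    and energy: "eventually (\<lambda>n. (\<Sum>i<n. \<Sum>j<n. (a n i j)\<^sup>2) \<le> C * real n * \<alpha> n) sequentially"
    and dev: "\<And>\<eta>. 0 < \<eta> \<Longrightarrow> eventually (\<lambda>n. \<forall>i<n. \<bar>d n i - (\<alpha> n + 1)\<bar> \<le> \<eta> * \<alpha> n) sequentially"
    and f: "continuous_on UNIV f" "bounded (range f)"
  shows "(\<lambda>n. integral\<^sup>L (empirical_spectral_measure (companion_mat n (a n) (d n) (sqrt (\<alpha> n)))) f
     - integral\<^sup>L (empirical_spectral_measure (companion_mat n (a n) (\<lambda>i. \<alpha> n + 1) (sqrt (\<alpha> n)))) f) \<longlonglongrightarrow> 0"
proof -
  define X where "X = (\<lambda>n. proots (char_poly (companion_mat n (a n) (d n) (sqrt (\<alpha> n)))))"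
  define Y where "Y = (\<lambda>n. proots (char_poly (companion_mat n (a n) (\<lambda>i. \<alpha> n + 1) (sqrt (\<alpha> n)))))"
  define b where "b = (\<lambda>n i j. a n i j / sqrt (\<alpha> n))"
  \<comment> \<open>The common diagonal \<open>e\<close> of the two pencils: \<open>t = 1\<close> gives \<open>X\<close>, \<open>t = 0\<close> gives \<open>Y\<close>.\<close>
  define e where "e = (\<lambda>n i. (d n i - (\<alpha> n + 1)) / \<alpha> n)"
  define \<epsilon> where "\<epsilon> = (\<lambda>n. Max (insert 0 ((\<lambda>i. \<bar>e n i\<bar>) ` {..<n})))"
  have \<epsilon>: "0 \<le> \<epsilon> n" "\<And>i. i < n \<Longrightarrow> \<bar>e n i\<bar> \<le> \<epsilon> n" for n
    unfolding \<epsilon>_def by (auto intro: Max_ge)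
  have symb: "b n i j = b n j i" if "i < n" "j < n" for n i j
    using sym[OF that] by (simp add: b_def)
  have \<epsilon>0: "\<epsilon> \<longlonglongrightarrow> 0"
  proof (rule LIMSEQ_I)
    fix \<eta> :: real assume \<eta>: "0 < \<eta>"
    then have "0 < \<eta> / 2" by simp
    from dev[OF this] pos have "eventually (\<lambda>n. norm (\<epsilon> n - 0) < \<eta>) sequentially"
    proof eventually_elim
      case (elim n)
      have "\<bar>e n i\<bar> \<le> \<eta> / 2" if "i < n" for i
        using elim that by (simp add: e_def abs_divide divide_le_eq)
      then have "\<epsilon> n \<le> \<eta> / 2" unfolding \<epsilon>_def using \<eta> by (intro Max.boundedI) auto
      then show ?case using \<epsilon>(1)[of n] \<eta> by simp
    qed
    then show "\<exists>n0. \<forall>n\<ge>n0. norm (\<epsilon> n - 0) < \<eta>" by (simp add: eventually_sequentially)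
  qed
  have prodX: "(\<Prod>x\<in>#X n. z - x) = det (pencil n (b n) (e n) 1 z)"
    and prodY: "(\<Prod>x\<in>#Y n. z - x) = det (pencil n (b n) (e n) 0 z)" if "0 < \<alpha> n" for n z
    unfolding X_def Y_def b_def using that
    by (auto intro!: prod_companion_eigenvalues simp: e_def field_simps)
  have sizes: "size (X n) = 2 * n" "size (Y n) = 2 * n" for n
    by (simp_all add: X_def Y_def size_companion_eigenvalues)
  have "(\<lambda>n. mset_mean f (X n) - mset_mean f (Y n)) \<longlonglongrightarrow> 0"
  proof (rule logarithmic_replacement[OF _ \<epsilon>0 _ _ _ _ _ f])
    show "eventually (\<lambda>n. X n \<noteq> {#}) sequentially" "eventually (\<lambda>n. Y n \<noteq> {#}) sequentially"
      using eventually_gt_at_top[of "0::nat"]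
      by (auto elim!: eventually_mono simp: nonempty_has_size sizes)
    show "eventually (\<lambda>n. \<forall>x\<in>#X n. \<bar>critical x\<bar> \<le> cmod x * \<epsilon> n) sequentially"
      using pos
    proof eventually_elim
      case (elim n)
      show ?case
      proof
        fix x assume "x \<in># X n"
        then have "(\<Prod>w\<in>#X n. x - w) = 0" by (auto simp: prod_mset_zero_iff)
        then have "det (pencil n (b n) (e n) 1 x) = 0" using prodX[OF elim] by simp
        from det_pencil_eq_0_imp_critical_le[OF symb \<epsilon>(2) this]
        show "\<bar>critical x\<bar> \<le> cmod x * \<epsilon> n" by simp
      qed
    qed
    show "eventually (\<lambda>n. \<forall>x\<in>#Y n. \<bar>critical x\<bar> \<le> cmod x * \<epsilon> n) sequentially"
      using pos
    proof eventually_elim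
      case (elim n)
      show ?case
      proof
        fix x assume "x \<in># Y n"
        then have "(\<Prod>w\<in>#Y n. x - w) = 0" by (auto simp: prod_mset_zero_iff)
        then have "det (pencil n (b n) (e n) 0 x) = 0" using prodY[OF elim] by simp
        from det_pencil_eq_0_imp_critical_le[OF symb \<epsilon>(2) this]
        show "\<bar>critical x\<bar> \<le> cmod x * \<epsilon> n" using \<epsilon>(1)[of n] by simp
      qed
    qed
    show "\<exists>R. eventually (\<lambda>n. real (size {#x \<in># Y n. R < cmod x#}) \<le> \<eta> * real (size (Y n))) sequentially"
      if \<eta>: "0 < \<eta>" for \<eta>
    proof -
      have "((\<lambda>y::real. ln ((y + 1) / (y - 1)) + (y / (y\<^sup>2 - 1))\<^sup>2 / 2 * C) \<longlongrightarrow> 0) at_top"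
        by real_asymp
      moreover have "0 < \<eta> * ln 2" using \<eta> by simp
      ultimately have "eventually (\<lambda>y::real. ln ((y + 1) / (y - 1)) + (y / (y\<^sup>2 - 1))\<^sup>2 / 2 * C < \<eta> * ln 2) at_top"
        by (rule order_tendstoD(2))
      then have "eventually (\<lambda>y::real. ln ((y + 1) / (y - 1)) + (y / (y\<^sup>2 - 1))\<^sup>2 / 2 * C < \<eta> * ln 2 \<and> 1 < y) at_top"
        using eventually_gt_at_top[of "1::real"] by eventually_elim simp
      then obtain y :: real where y: "ln ((y + 1) / (y - 1)) + (y / (y\<^sup>2 - 1))\<^sup>2 / 2 * C < \<eta> * ln 2" "1 < y"
        unfolding eventually_at_top_linorder by blast
      have "eventually (\<lambda>n. real (size {#x \<in># Y n. y < cmod x#}) \<le> \<eta> * real (size (Y n))) sequentially"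
        using pos energy
      proof eventually_elim
        case (elim n)
        have "(\<Sum>i<n. \<Sum>j<n. (b n i j)\<^sup>2) = (\<Sum>i<n. \<Sum>j<n. (a n i j)\<^sup>2) / \<alpha> n"
          using elim by (simp add: b_def power_divide sum_divide_distrib)
        also have "\<dots> \<le> C * real n" using elim by (simp add: divide_le_eq)
        finally have en: "(\<Sum>i<n. \<Sum>j<n. (b n i j)\<^sup>2) \<le> C * real n" .
        have "real (size {#x \<in># Y n. y < cmod x#}) * (ln 2 / 2)
            \<le> real n * ln ((y + 1) / (y - 1)) + (y / (y\<^sup>2 - 1))\<^sup>2 / 2 * (\<Sum>i<n. \<Sum>j<n. (b n i j)\<^sup>2)"
          using card_large_roots_le[OF symb prodY[OF elim(1)] sizes(2) y(2)] by simp
        also have "\<dots> \<le> real n * ln ((y + 1) / (y - 1)) + (y / (y\<^sup>2 - 1))\<^sup>2 / 2 * (C * real n)"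
          using en by (intro add_left_mono mult_left_mono) auto
        also have "\<dots> = real n * (ln ((y + 1) / (y - 1)) + (y / (y\<^sup>2 - 1))\<^sup>2 / 2 * C)"
          by (simp add: algebra_simps)
        also have "\<dots> \<le> real n * (\<eta> * ln 2)" using y(1) by (intro mult_left_mono) auto
        also have "\<dots> = (\<eta> * real (size (Y n))) * (ln 2 / 2)" by (simp add: sizes)
        finally show ?case by (rule mult_right_le_imp_le) simp
      qed
      then show ?thesis by blast
    qed
    show "(\<lambda>n. mset_mean (\<lambda>x. ln (cmod (z - x))) (X n) - mset_mean (\<lambda>x. ln (cmod (z - x))) (Y n)) \<longlonglongrightarrow> 0"
      if z: "critical z \<noteq> 0" for z
    proof (rule Lim_null_comparison)
      define x where "x = (\<lambda>n. cmod z * \<epsilon> n / \<bar>critical z\<bar>)"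
      have x0: "x \<longlonglongrightarrow> cmod z * 0 / \<bar>critical z\<bar>"
        unfolding x_def by (intro tendsto_intros \<epsilon>0) (use z in auto)
      then show "(\<lambda>n. - ln (1 - x n) / 2) \<longlonglongrightarrow> 0"
        by (auto intro!: tendsto_eq_intros)
      have "eventually (\<lambda>n. x n < 1) sequentially"
        using x0 by (intro order_tendstoD) auto
      with pos eventually_gt_at_top[of "0::nat"]
      show "eventually (\<lambda>n. norm (mset_mean (\<lambda>x. ln (cmod (z - x))) (X n) - mset_mean (\<lambda>x. ln (cmod (z - x))) (Y n))
          \<le> - ln (1 - x n) / 2) sequentially"
      proof eventually_elim
        case (elim n)
        have small: "cmod z * \<epsilon> n < \<bar>critical z\<bar>" using elim z by (simp add: x_def divide_less_eq)
        have det0: "det (pencil n (b n) (e n) t z) \<noteq> 0" if "cmod t \<le> 1" for t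
        proof
          assume "det (pencil n (b n) (e n) t z) = 0"
          from det_pencil_eq_0_imp_critical_le[OF symb \<epsilon>(2) this]
          have "\<bar>critical z\<bar> \<le> cmod t * (cmod z * \<epsilon> n)" by (simp add: mult.assoc)
          also have "\<dots> \<le> 1 * (cmod z * \<epsilon> n)" using that \<epsilon>(1)[of n] by (intro mult_right_mono) auto
          finally show False using small by simp
        qed
        have mean: "mset_mean (\<lambda>x. ln (cmod (z - x))) Z = ln (cmod (\<Prod>x\<in>#Z. z - x)) / real (size Z)"
          if "(\<Prod>x\<in>#Z. z - x) \<noteq> 0" for Z
        proof -
          have "z \<noteq> x" if "x \<in># Z" for x
            using \<open>(\<Prod>x\<in>#Z. z - x) \<noteq> 0\<close> that by (auto simp: prod_mset_zero_iff)
          then show ?thesis using ln_cmod_prod_mset[of Z z]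
            by (simp add: mset_mean_def norm_minus_commute)
        qed
        have "mset_mean (\<lambda>x. ln (cmod (z - x))) (X n) - mset_mean (\<lambda>x. ln (cmod (z - x))) (Y n)
          = (ln (cmod (det (pencil n (b n) (e n) 1 z))) - ln (cmod (det (pencil n (b n) (e n) 0 z)))) / (2 * real n)"
          using det0[of 1] det0[of 0] prodX[OF elim(1)] prodY[OF elim(1)]
          by (simp add: mean sizes diff_divide_distrib)
        also have "norm \<dots> = \<bar>ln (cmod (det (pencil n (b n) (e n) 1 z))) - ln (cmod (det (pencil n (b n) (e n) 0 z)))\<bar> / (2 * real n)"
          by (simp add: abs_divide)
        also have "\<dots> \<le> (real n * (- ln (1 - x n))) / (2 * real n)"
          unfolding x_def by (intro divide_right_mono abs_ln_det_pencil_diff_le[OF symb \<epsilon>(2) \<epsilon>(1) small]) auto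
        also have "\<dots> = - ln (1 - x n) / 2" using elim by simp
        finally show ?case .
      qed
    qed
  qed
  moreover have "eventually (\<lambda>n. mset_mean f (X n) - mset_mean f (Y n) =
      integral\<^sup>L (empirical_spectral_measure (companion_mat n (a n) (d n) (sqrt (\<alpha> n)))) f
     - integral\<^sup>L (empirical_spectral_measure (companion_mat n (a n) (\<lambda>i. \<alpha> n + 1) (sqrt (\<alpha> n)))) f) sequentially"
    using eventually_gt_at_top[of "0::nat"]
    by eventually_elim (simp add: integral_esm_companion f(1) X_def Y_def)
  ultimately show ?thesis by (rule Lim_transform_eventually)
qed

section \<open>Concentration of the degrees\<close>

lemma exp_le_quadratic:
  fixes t :: real
  assumes "\<bar>t\<bar> \<le> 1"
  shows "exp t \<le> 1 + t + t\<^sup>2"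
proof (cases "0 \<le> t")
  case True
  then show ?thesis using exp_bound[of t] assms by simp
next
  case False
  define u where "u = - t"
  have u: "0 \<le> u" "u \<le> 1" using False assms by (auto simp: u_def)
  have "1 \<le> (1 - u + u\<^sup>2) * (1 + u)"
    using u by (simp add: algebra_simps power2_eq_square)
  also have "\<dots> \<le> (1 - u + u\<^sup>2) * exp u"
  proof (rule mult_left_mono)
    show "0 \<le> 1 - u + u\<^sup>2" using u by simp
  qed (rule exp_ge_add_one_self)
  finally have "exp (- u) \<le> 1 - u + u\<^sup>2"
    by (simp add: exp_minus field_simps)
  then show ?thesis by (simp add: u_def)
qed

text \<open>On each event the exponential of \<open>t\<close> times an indicator is \<open>1 + (exp t - 1)\<close> times the indicator. Expanding
the product over \<open>S\<close> into a sum over subsets reduces the expectation to the probabilities of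
intersections, which are what independence of events prescribes.\<close>

lemma (in prob_space) indep_events_mgf:
  assumes ind: "indep_events E I" and S: "finite S" "S \<subseteq> I" and p: "\<And>e. e \<in> S \<Longrightarrow> prob (E e) = p"
  shows "expectation (\<lambda>\<omega>. exp (t * (\<Sum>e\<in>S. indicator (E e) \<omega>))) = (1 + p * (exp t - 1)) ^ card S"
    and "integrable M (\<lambda>\<omega>. exp (t * (\<Sum>e\<in>S. indicator (E e) \<omega>)))"
proof -
  define c where "c = exp t - 1"
  have ev: "E e \<in> events" if "e \<in> S" for e
    using ind S(2) that unfolding indep_events_def by auto
  have exp_eq: "exp (t * (\<Sum>e\<in>S. indicator (E e) \<omega>)) = (\<Sum>X\<in>Pow S. c ^ card X * indicator (space M \<inter> (\<Inter>e\<in>X. E e)) \<omega>)"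
    if "\<omega> \<in> space M" for \<omega>
  proof -
    have "exp (t * (\<Sum>e\<in>S. indicator (E e) \<omega>)) = (\<Prod>e\<in>S. exp (t * indicator (E e) \<omega>))"
      by (simp only: sum_distrib_left exp_sum[OF S(1)])
    also have "\<dots> = (\<Prod>e\<in>S. c * indicator (E e) \<omega> + 1)"
      by (intro prod.cong refl) (simp add: c_def indicator_def)
    also have "\<dots> = (\<Sum>X\<in>Pow S. (\<Prod>e\<in>X. c * indicator (E e) \<omega>))"
      using prod_add[OF S(1), of "\<lambda>e. c * indicator (E e) \<omega>" "\<lambda>_. 1"] by simp
    also have "\<dots> = (\<Sum>X\<in>Pow S. c ^ card X * indicator (space M \<inter> (\<Inter>e\<in>X. E e)) \<omega>)"
    proof (rule sum.cong[OF refl])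
      fix X assume "X \<in> Pow S"
      then have X: "finite X" using S(1) finite_subset by auto
      have "(\<Prod>e\<in>X. indicator (E e) \<omega>) = (indicator (space M \<inter> (\<Inter>e\<in>X. E e)) \<omega> :: real)"
        using X that by (induction X rule: finite_induct) (auto simp: indicator_def)
      then show "(\<Prod>e\<in>X. c * indicator (E e) \<omega>) = c ^ card X * indicator (space M \<inter> (\<Inter>e\<in>X. E e)) \<omega>"
        by (simp add: prod.distrib)
    qed
    finally show ?thesis .
  qed
  have meas: "space M \<inter> (\<Inter>e\<in>X. E e) \<in> events" if "X \<in> Pow S" for X
  proof (cases "X = {}")
    case False
    have "finite X" using that S(1) finite_subset by auto
    then have "(\<Inter>e\<in>X. E e) \<in> events" using False that ev by (intro sets.finite_INT) auto
    then show ?thesis by auto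
  qed auto
  have pr: "prob (space M \<inter> (\<Inter>e\<in>X. E e)) = p ^ card X" if "X \<in> Pow S" for X
  proof (cases "X = {}")
    case True
    then show ?thesis by (simp add: prob_space)
  next
    case False
    have X: "finite X" "X \<subseteq> I" using that S finite_subset by auto
    have "(\<Inter>e\<in>X. E e) \<subseteq> space M" using False that ev sets.sets_into_space by blast
    then have "space M \<inter> (\<Inter>e\<in>X. E e) = (\<Inter>e\<in>X. E e)" by blast
    moreover have "prob (\<Inter>e\<in>X. E e) = (\<Prod>e\<in>X. prob (E e))"
      using ind X False unfolding indep_events_def by blast
    moreover have "(\<Prod>e\<in>X. prob (E e)) = (\<Prod>e\<in>X. p)"
      using that p by (intro prod.cong) auto
    ultimately show ?thesis by simp
  qed
  have int: "integrable M (\<lambda>\<omega>. c ^ card X * indicator (space M \<inter> (\<Inter>e\<in>X. E e)) \<omega>)" if "X \<in> Pow S" for X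
    using meas[OF that] by (intro integrable_mult_right integrable_real_indicator) (auto simp: emeasure_eq_measure)
  have "expectation (\<lambda>\<omega>. exp (t * (\<Sum>e\<in>S. indicator (E e) \<omega>)))
      = expectation (\<lambda>\<omega>. \<Sum>X\<in>Pow S. c ^ card X * indicator (space M \<inter> (\<Inter>e\<in>X. E e)) \<omega>)"
    by (intro Bochner_Integration.integral_cong refl exp_eq)
  also have "\<dots> = (\<Sum>X\<in>Pow S. c ^ card X * p ^ card X)"
    using int meas pr by (subst Bochner_Integration.integral_sum) (auto simp: Int_absorb1)
  also have "\<dots> = (\<Sum>X\<in>Pow S. (\<Prod>e\<in>X. p * c) * (\<Prod>e\<in>S - X. 1))"
    by (simp add: power_mult_distrib mult.commute)
  also have "\<dots> = (\<Prod>e\<in>S. p * c + 1)"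
    by (rule prod_add[OF S(1), symmetric])
  finally show "expectation (\<lambda>\<omega>. exp (t * (\<Sum>e\<in>S. indicator (E e) \<omega>))) = (1 + p * (exp t - 1)) ^ card S"
    by (simp add: c_def add.commute)
  have "integrable M (\<lambda>\<omega>. \<Sum>X\<in>Pow S. c ^ card X * indicator (space M \<inter> (\<Inter>e\<in>X. E e)) \<omega>)"
    using int by (intro Bochner_Integration.integrable_sum) auto
  then show "integrable M (\<lambda>\<omega>. exp (t * (\<Sum>e\<in>S. indicator (E e) \<omega>)))"
    by (rule Bochner_Integration.integrable_cong[THEN iffD1, OF refl, rotated]) (simp add: exp_eq)
qed

text \<open>Positive \<open>t\<close> gives the upper tail and negative \<open>t\<close> the lower tail. The variance factor \<open>m\<close> in the exponent,
rather than the number of events, is essential: it is what makes the bound useful for small \<open>p\<close>.\<close>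

lemma (in prob_space) indep_events_chernoff_one_sided:
  assumes ind: "indep_events E I" and S: "finite S" "S \<subseteq> I" and p: "\<And>e. e \<in> S \<Longrightarrow> prob (E e) = p"
    and p01: "0 \<le> p" "p \<le> 1" and t: "\<bar>t\<bar> \<le> 1"
  defines "m \<equiv> real (card S) * p"
  shows "prob {\<omega> \<in> space M. u \<le> t * ((\<Sum>e\<in>S. indicator (E e) \<omega>) - m)} \<le> exp (m * t\<^sup>2 - u)"
proof -
  let ?Z = "\<lambda>\<omega>. \<Sum>e\<in>S. indicator (E e) \<omega> :: real"
  have mgf: "expectation (\<lambda>\<omega>. exp (t * ?Z \<omega>)) = (1 + p * (exp t - 1)) ^ card S"
    "integrable M (\<lambda>\<omega>. exp (t * ?Z \<omega>))"
    using indep_events_mgf[OF ind S, of p t] p by auto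
  have "prob {\<omega> \<in> space M. u \<le> t * (?Z \<omega> - m)} = prob {\<omega> \<in> space M. exp (u + t * m) \<le> exp (t * ?Z \<omega>)}"
    by (rule arg_cong[where f=prob]) (auto simp: algebra_simps)
  also have "\<dots> \<le> expectation (\<lambda>\<omega>. exp (t * ?Z \<omega>)) / exp (u + t * m)"
    by (rule integral_Markov_inequality_measure[OF mgf(2), where A="space M"]) auto
  also have "\<dots> \<le> exp (m * (t + t\<^sup>2)) / exp (u + t * m)"
  proof (rule divide_right_mono)
    have "0 \<le> (1 - p) + p * exp t" using p01 by (intro add_nonneg_nonneg mult_nonneg_nonneg) auto
    then have nonneg: "0 \<le> 1 + p * (exp t - 1)" by (simp add: algebra_simps)
    have "exp t - 1 \<le> t + t\<^sup>2" using exp_le_quadratic[OF t] by simp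
    then have "1 + p * (exp t - 1) \<le> 1 + p * (t + t\<^sup>2)" using p01 by (intro add_left_mono mult_left_mono) auto
    also have "\<dots> \<le> exp (p * (t + t\<^sup>2))" by (rule exp_ge_add_one_self)
    finally have "(1 + p * (exp t - 1)) ^ card S \<le> exp (p * (t + t\<^sup>2)) ^ card S"
      using nonneg by (rule power_mono)
    also have "\<dots> = exp (m * (t + t\<^sup>2))"
      by (simp add: m_def exp_of_nat_mult[symmetric] mult.assoc)
    finally show "expectation (\<lambda>\<omega>. exp (t * ?Z \<omega>)) \<le> exp (m * (t + t\<^sup>2))"
      unfolding mgf(1) .
  qed auto
  also have "\<dots> = exp (m * t\<^sup>2 - u)"
    by (simp add: exp_diff[symmetric] algebra_simps)
  finally show ?thesis .
qed

lemma (in prob_space) indep_events_chernoff: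
  assumes ind: "indep_events E I" and S: "finite S" "S \<subseteq> I" and p: "\<And>e. e \<in> S \<Longrightarrow> prob (E e) = p"
    and p01: "0 \<le> p" "p \<le> 1" and \<epsilon>: "0 \<le> \<epsilon>" "\<epsilon> \<le> 1"
  defines "m \<equiv> real (card S) * p"
  shows "prob {\<omega> \<in> space M. \<epsilon> * m \<le> \<bar>(\<Sum>e\<in>S. indicator (E e) \<omega>) - m\<bar>} \<le> 2 * exp (- (\<epsilon>\<^sup>2 * m / 4))"
proof -
  define F where "F = (\<lambda>t. {\<omega> \<in> space M. \<epsilon>\<^sup>2 * m / 2 \<le> t * ((\<Sum>e\<in>S. indicator (E e) \<omega>) - m)})"
  have ev: "E e \<in> events" if "e \<in> S" for e
    using ind S(2) that unfolding indep_events_def by auto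
  have F: "F t \<in> events" for t unfolding F_def using ev by measurable
  have one: "prob (F t) \<le> exp (- (\<epsilon>\<^sup>2 * m / 4))" if t: "t = \<epsilon> / 2 \<or> t = - (\<epsilon> / 2)" for t
  proof -
    \<comment> \<open>The exponent \<open>m * t\<^sup>2 - \<bar>t\<bar> * \<epsilon> * m\<close> is minimal at \<open>\<bar>t\<bar> = \<epsilon> / 2\<close>.\<close>
    have t2: "t\<^sup>2 = \<epsilon>\<^sup>2 / 4" using t by (auto simp: power_divide)
    have "prob (F t) \<le> exp (m * t\<^sup>2 - \<epsilon>\<^sup>2 * m / 2)"
      unfolding F_def m_def
      by (rule indep_events_chernoff_one_sided[OF ind S p p01]) (use t \<epsilon> in auto)
    also have "m * t\<^sup>2 - \<epsilon>\<^sup>2 * m / 2 = - (\<epsilon>\<^sup>2 * m / 4)" unfolding t2 by simp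
    finally show ?thesis .
  qed
  have "prob {\<omega> \<in> space M. \<epsilon> * m \<le> \<bar>(\<Sum>e\<in>S. indicator (E e) \<omega>) - m\<bar>} \<le> prob (F (\<epsilon> / 2) \<union> F (- (\<epsilon> / 2)))"
  proof (rule finite_measure_mono)
    show "{\<omega> \<in> space M. \<epsilon> * m \<le> \<bar>(\<Sum>e\<in>S. indicator (E e) \<omega>) - m\<bar>} \<subseteq> F (\<epsilon> / 2) \<union> F (- (\<epsilon> / 2))"
    proof
      fix \<omega> assume "\<omega> \<in> {\<omega> \<in> space M. \<epsilon> * m \<le> \<bar>(\<Sum>e\<in>S. indicator (E e) \<omega>) - m\<bar>}"
      then have \<omega>: "\<omega> \<in> space M" "\<epsilon> * m \<le> \<bar>(\<Sum>e\<in>S. indicator (E e) \<omega>) - m\<bar>" by auto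
      define x where "x = (\<Sum>e\<in>S. indicator (E e) \<omega>) - m"
      have "\<epsilon> / 2 * (\<epsilon> * m) \<le> \<epsilon> / 2 * \<bar>x\<bar>"
        using \<omega>(2) \<epsilon> unfolding x_def by (intro mult_left_mono) auto
      then have "\<epsilon>\<^sup>2 * m / 2 \<le> \<epsilon> / 2 * \<bar>x\<bar>" by (simp add: power2_eq_square)
      then have "\<epsilon>\<^sup>2 * m / 2 \<le> \<epsilon> / 2 * x \<or> \<epsilon>\<^sup>2 * m / 2 \<le> - (\<epsilon> / 2) * x"
        by (cases "0 \<le> x") auto
      then show "\<omega> \<in> F (\<epsilon> / 2) \<union> F (- (\<epsilon> / 2))"
        using \<omega>(1) unfolding F_def x_def by blast
    qed
  qed (use F in auto)
  also have "\<dots> \<le> prob (F (\<epsilon> / 2)) + prob (F (- (\<epsilon> / 2)))"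
    by (rule measure_Un_le) (rule F)+
  also have "\<dots> \<le> 2 * exp (- (\<epsilon>\<^sup>2 * m / 4))" using one[of "\<epsilon> / 2"] one[of "- (\<epsilon> / 2)"] by simp
  finally show ?thesis .
qed

definition vertex_degree :: "nat \<Rightarrow> nat set set \<Rightarrow> nat \<Rightarrow> real" where
  "vertex_degree n E i = (\<Sum>k<n. if {i, k} \<in> E then 1 else 0)"

definition incident_pairs :: "nat \<Rightarrow> nat \<Rightarrow> nat set set" where
  "incident_pairs n i = (\<lambda>k. {i, k}) ` ({..<n} - {i})"

lemma incident_pairs:
  assumes "i < n"
  shows "incident_pairs n i \<subseteq> vertex_pairs n" "finite (incident_pairs n i)"
    "card (incident_pairs n i) = n - 1" "inj_on (\<lambda>k. {i, k}) ({..<n} - {i})"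
proof -
  show inj: "inj_on (\<lambda>k. {i, k}) ({..<n} - {i})"
    by (auto simp: inj_on_def doubleton_eq_iff)
  show "card (incident_pairs n i) = n - 1"
    unfolding incident_pairs_def using assms by (simp add: card_image[OF inj])
  show "finite (incident_pairs n i)" by (simp add: incident_pairs_def)
  show "incident_pairs n i \<subseteq> vertex_pairs n"
  proof
    fix e assume "e \<in> incident_pairs n i"
    then obtain k where k: "k < n" "k \<noteq> i" "e = {i, k}" by (auto simp: incident_pairs_def)
    then show "e \<in> vertex_pairs n"
    proof (cases "i < k")
      case True
      then show ?thesis using k unfolding vertex_pairs_def by blast
    next
      case False
      then have "k < i" "e = {k, i}" using k by auto
      then show ?thesis using assms unfolding vertex_pairs_def by blast
    qed
  qed
qed

lemma vertex_degree_eq_sum_indicator: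
  assumes G: "G \<omega> \<subseteq> vertex_pairs n" and "\<omega> \<in> space M" "i < n"
  shows "vertex_degree n (G \<omega>) i = (\<Sum>e\<in>incident_pairs n i. indicator {\<omega> \<in> space M. e \<in> G \<omega>} \<omega>)"
proof -
  have "{i, i} \<notin> vertex_pairs n" by (auto simp: vertex_pairs_def)
  then have "{i, i} \<notin> G \<omega>" using G by blast
  then have "vertex_degree n (G \<omega>) i = (\<Sum>k\<in>{..<n} - {i}. if {i, k} \<in> G \<omega> then 1 else 0)"
    unfolding vertex_degree_def by (intro sum.mono_neutral_right) auto
  also have "\<dots> = (\<Sum>e\<in>incident_pairs n i. if e \<in> G \<omega> then 1 else 0)"
    unfolding incident_pairs_def by (subst sum.reindex[OF incident_pairs(4)[OF assms(3)]]) simp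
  also have "\<dots> = (\<Sum>e\<in>incident_pairs n i. indicator {\<omega> \<in> space M. e \<in> G \<omega>} \<omega>)"
    using assms(2) by (intro sum.cong) (auto simp: indicator_def)
  finally show ?thesis .
qed

lemma erdos_renyi_degree_tail:
  assumes M: "prob_space M" and ER: "erdos_renyi M n p G" and p: "0 \<le> p" "p \<le> 1"
    and i: "i < n" and \<epsilon>: "0 \<le> \<epsilon>" "\<epsilon> \<le> 1"
  defines "m \<equiv> (real n - 1) * p"
  shows "measure M {\<omega> \<in> space M. \<epsilon> * m \<le> \<bar>vertex_degree n (G \<omega>) i - m\<bar>} \<le> 2 * exp (- (\<epsilon>\<^sup>2 * m / 4))"
    and "(\<lambda>\<omega>. vertex_degree n (G \<omega>) i) \<in> borel_measurable M"
    and "(\<integral>\<omega>. vertex_degree n (G \<omega>) i \<partial>M) = m"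
proof -
  interpret prob_space M by fact
  define E where "E = (\<lambda>e. {\<omega> \<in> space M. e \<in> G \<omega>})"
  have ind: "indep_events E (vertex_pairs n)" and pE: "\<And>e. e \<in> vertex_pairs n \<Longrightarrow> prob (E e) = p"
    and sub: "\<And>\<omega>. \<omega> \<in> space M \<Longrightarrow> G \<omega> \<subseteq> vertex_pairs n"
    using ER by (auto simp: erdos_renyi_def E_def)
  note S = incident_pairs[OF i]
  have ev: "E e \<in> events" if "e \<in> incident_pairs n i" for e
    using ind S(1) that unfolding indep_events_def by auto
  have deg: "vertex_degree n (G \<omega>) i = (\<Sum>e\<in>incident_pairs n i. indicator (E e) \<omega>)" if "\<omega> \<in> space M" for \<omega>
    unfolding E_def by (rule vertex_degree_eq_sum_indicator[of G \<omega>, OF sub[OF that] that i])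
  have m: "m = real (card (incident_pairs n i)) * p"
    using i by (simp add: m_def S(3) of_nat_diff)
  have "{\<omega> \<in> space M. \<epsilon> * m \<le> \<bar>vertex_degree n (G \<omega>) i - m\<bar>}
     = {\<omega> \<in> space M. \<epsilon> * m \<le> \<bar>(\<Sum>e\<in>incident_pairs n i. indicator (E e) \<omega>) - m\<bar>}"
    using deg by auto
  then show "measure M {\<omega> \<in> space M. \<epsilon> * m \<le> \<bar>vertex_degree n (G \<omega>) i - m\<bar>} \<le> 2 * exp (- (\<epsilon>\<^sup>2 * m / 4))"
    unfolding m using indep_events_chernoff[OF ind S(2,1) _ p \<epsilon>] pE S(1) by auto
  have "(\<lambda>\<omega>. \<Sum>e\<in>incident_pairs n i. indicator (E e) \<omega> :: real) \<in> borel_measurable M"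
    using ev by (intro borel_measurable_sum borel_measurable_indicator)
  then show "(\<lambda>\<omega>. vertex_degree n (G \<omega>) i) \<in> borel_measurable M"
    by (subst measurable_cong[OF deg]) auto
  have "(\<integral>\<omega>. vertex_degree n (G \<omega>) i \<partial>M) = (\<integral>\<omega>. (\<Sum>e\<in>incident_pairs n i. indicator (E e) \<omega>) \<partial>M)"
    by (intro Bochner_Integration.integral_cong refl deg)
  also have "\<dots> = (\<Sum>e\<in>incident_pairs n i. prob (E e))"
    using ev by (subst Bochner_Integration.integral_sum)
      (auto simp: emeasure_eq_measure Int_absorb1 sets.sets_into_space intro!: sum.cong)
  also have "\<dots> = (\<Sum>e\<in>incident_pairs n i. p)" using S(1) pE by (intro sum.cong) auto
  finally show "(\<integral>\<omega>. vertex_degree n (G \<omega>) i \<partial>M) = m" by (simp add: m)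
qed

section \<open>Random graphs and their spectral measures\<close>

lemma ln_le_expected_degree:
  fixes p :: "nat \<Rightarrow> real"
  assumes p: "\<And>n. n \<ge> 1 \<Longrightarrow> 0 < p n" and lim: "filterlim (\<lambda>n. real n * p n / ln (real n)) at_top sequentially"
  shows "eventually (\<lambda>n. K * ln (real n) \<le> (real n - 1) * p n) sequentially"
proof -
  have "eventually (\<lambda>n. 2 * K \<le> real n * p n / ln (real n)) sequentially"
    using lim by (simp add: filterlim_at_top)
  with eventually_ge_at_top[of "2::nat"] show ?thesis
  proof eventually_elim
    case (elim n)
    have ln: "0 < ln (real n)" using elim by simp
    have "2 * K * ln (real n) \<le> real n * p n" using elim(2) ln by (simp add: pos_le_divide_eq)
    also have "\<dots> \<le> (2 * (real n - 1)) * p n" using elim p[of n] by (intro mult_right_mono) auto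
    finally show ?case unfolding mult.assoc by linarith
  qed
qed

lemma expected_degree_at_top:
  fixes p :: "nat \<Rightarrow> real"
  assumes p: "\<And>n. n \<ge> 1 \<Longrightarrow> 0 < p n" and lim: "filterlim (\<lambda>n. real n * p n / ln (real n)) at_top sequentially"
  shows "filterlim (\<lambda>n. (real n - 1) * p n) at_top sequentially"
proof (rule filterlim_at_top_mono)
  show "filterlim (\<lambda>n. 1 * ln (real n)) at_top sequentially" by real_asymp
  show "eventually (\<lambda>n. 1 * ln (real n) \<le> (real n - 1) * p n) sequentially"
    by (rule ln_le_expected_degree[OF p lim])
qed

text \<open>The assumption on \<open>n p / ln n\<close> makes the expected degree exceed every multiple of \<open>ln n\<close>. The Chernoff
bound then yields a failure probability of at most \<open>2 / n\<^sup>2\<close> for all \<open>n\<close> vertices together, which is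
summable. The first Borel--Cantelli lemma applies to every joint distribution of the graphs.\<close>

lemma AE_erdos_renyi_degree_concentration:
  fixes p :: "nat \<Rightarrow> real"
  assumes M: "prob_space M" and p: "\<And>n. n \<ge> 1 \<Longrightarrow> 0 < p n \<and> p n \<le> 1"
    and lim: "filterlim (\<lambda>n. real n * p n / ln (real n)) at_top sequentially"
    and ER: "\<And>n. n \<ge> 1 \<Longrightarrow> erdos_renyi M n (p n) (G n)"
  shows "AE \<omega> in M. \<forall>\<eta>>0. eventually (\<lambda>n. \<forall>i<n.
    \<bar>vertex_degree n (G n \<omega>) i - (real n - 1) * p n\<bar> \<le> \<eta> * ((real n - 1) * p n)) sequentially"
proof -
  interpret prob_space M by fact
  define m where "m = (\<lambda>n. (real n - 1) * p n)"
  have fixed: "AE \<omega> in M. eventually (\<lambda>n. \<forall>i<n.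
      \<bar>vertex_degree n (G n \<omega>) i - m n\<bar> \<le> \<epsilon> * m n) sequentially" if \<epsilon>: "0 < \<epsilon>" "\<epsilon> \<le> 1" for \<epsilon>
  proof -
    define B where "B = (\<lambda>n i. {\<omega> \<in> space M. \<epsilon> * m n \<le> \<bar>vertex_degree n (G n \<omega>) i - m n\<bar>})"
    have B: "B n i \<in> events" "prob (B n i) \<le> 2 * exp (- (\<epsilon>\<^sup>2 * m n / 4))" if "i < n" for n i
    proof -
      have n: "n \<ge> 1" using that by simp
      note T = erdos_renyi_degree_tail[OF M ER[OF n] _ _ that, of \<epsilon>, folded m_def]
      show "B n i \<in> events"
      proof -
        have [measurable]: "(\<lambda>\<omega>. vertex_degree n (G n \<omega>) i) \<in> borel_measurable M"
          using T(2) p[OF n] \<epsilon> by simp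
        show ?thesis unfolding B_def by measurable
      qed
      show "prob (B n i) \<le> 2 * exp (- (\<epsilon>\<^sup>2 * m n / 4))"
        unfolding B_def m_def using T(1) p[OF n] \<epsilon> by (simp add: m_def)
    qed
    have bad: "prob (\<Union>i<n. B n i) \<le> real n * (2 * exp (- (\<epsilon>\<^sup>2 * m n / 4)))" for n
    proof -
      have "prob (\<Union>i<n. B n i) \<le> (\<Sum>i<n. prob (B n i))"
        using B(1) by (intro finite_measure_subadditive_finite) auto
      also have "\<dots> \<le> (\<Sum>i<n. 2 * exp (- (\<epsilon>\<^sup>2 * m n / 4)))"
        using B(2) by (intro sum_mono) auto
      finally show ?thesis by simp
    qed
    have "summable (\<lambda>n. prob (\<Union>i<n. B n i))"
    proof (rule summable_comparison_test_ev)
      show "summable (\<lambda>n. 2 * inverse (real n ^ 2))"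
        by (intro summable_mult inverse_power_summable) simp
      \<comment> \<open>The factor \<open>12 / \<epsilon>\<^sup>2\<close> makes \<open>exp (- (\<epsilon>\<^sup>2 * m n / 4))\<close> at most \<open>1 / n ^ 3\<close>.\<close>
      have "eventually (\<lambda>n. 12 / \<epsilon>\<^sup>2 * ln (real n) \<le> m n) sequentially"
        unfolding m_def using p by (intro ln_le_expected_degree lim) auto
      with eventually_gt_at_top[of "0::nat"]
      show "eventually (\<lambda>n. norm (prob (\<Union>i<n. B n i)) \<le> 2 * inverse (real n ^ 2)) sequentially"
      proof eventually_elim
        case (elim n)
        have "3 * ln (real n) \<le> \<epsilon>\<^sup>2 * m n / 4"
          using elim(2) \<epsilon> by (simp add: field_simps)
        then have "exp (- (\<epsilon>\<^sup>2 * m n / 4)) \<le> exp (- (3 * ln (real n)))" by simp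
        also have "\<dots> = inverse (real n ^ 3)"
          using elim(1) by (simp add: exp_minus exp_of_nat_mult[of 3 "ln (real n)", simplified])
        finally have "real n * (2 * exp (- (\<epsilon>\<^sup>2 * m n / 4))) \<le> real n * (2 * inverse (real n ^ 3))"
          by (intro mult_left_mono) auto
        also have "\<dots> = 2 * inverse (real n ^ 2)"
          using elim(1) by (simp add: field_simps power2_eq_square power3_eq_cube)
        finally show ?case using bad[of n] by simp
      qed
    qed
    moreover have "(\<Union>i<n. B n i) \<in> events" for n using B(1) by auto
    ultimately have "AE \<omega> in M. eventually (\<lambda>n. \<omega> \<in> space M - (\<Union>i<n. B n i)) sequentially"
      by (intro borel_cantelli_AE1) (auto simp: emeasure_eq_measure)
    then show ?thesis
    proof (rule AE_mp, intro AE_I2 impI)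
      fix \<omega> assume "eventually (\<lambda>n. \<omega> \<in> space M - (\<Union>i<n. B n i)) sequentially"
      then show "eventually (\<lambda>n. \<forall>i<n. \<bar>vertex_degree n (G n \<omega>) i - m n\<bar> \<le> \<epsilon> * m n) sequentially"
        by eventually_elim (force simp: B_def not_le)
    qed
  qed
  have "AE \<omega> in M. \<forall>k::nat. eventually (\<lambda>n. \<forall>i<n.
      \<bar>vertex_degree n (G n \<omega>) i - m n\<bar> \<le> 1 / real (Suc k) * m n) sequentially"
    unfolding AE_all_countable by (intro allI fixed) auto
  then show ?thesis
  proof (rule AE_mp, intro AE_I2 impI allI)
    fix \<omega> \<eta> assume *: "\<forall>k::nat. eventually (\<lambda>n. \<forall>i<n.
      \<bar>vertex_degree n (G n \<omega>) i - m n\<bar> \<le> 1 / real (Suc k) * m n) sequentially" and \<eta>: "(0::real) < \<eta>"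
    obtain k where k: "1 / real (Suc k) < \<eta>" using nat_approx_posE[OF \<eta>] by blast
    from *[rule_format, of k] eventually_ge_at_top[of "1::nat"]
    show "eventually (\<lambda>n. \<forall>i<n. \<bar>vertex_degree n (G n \<omega>) i - (real n - 1) * p n\<bar> \<le> \<eta> * ((real n - 1) * p n)) sequentially"
    proof eventually_elim
      case (elim n)
      have "0 \<le> m n" using p[of n] elim(2) by (simp add: m_def)
      then have "1 / real (Suc k) * m n \<le> \<eta> * m n" using k by (intro mult_right_mono) auto
      then show ?case using elim(1) unfolding m_def by (meson order_trans)
    qed
  qed
qed

text \<open>The random graph takes finitely many values, each on a measurable set, so every function of it is a
random variable. In particular, integrals against its spectral measures are.\<close>

lemma erdos_renyi_measurable:
  fixes F :: "nat set set \<Rightarrow> real"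
  assumes M: "prob_space M" and ER: "erdos_renyi M n p G"
  shows "(\<lambda>\<omega>. F (G \<omega>)) \<in> borel_measurable M"
proof -
  interpret prob_space M by fact
  have fin: "finite (vertex_pairs n)"
    by (rule finite_subset[of _ "Pow {..<n}"]) (auto simp: vertex_pairs_def)
  have sub: "\<And>\<omega>. \<omega> \<in> space M \<Longrightarrow> G \<omega> \<subseteq> vertex_pairs n"
    and ev: "\<And>e. e \<in> vertex_pairs n \<Longrightarrow> {\<omega> \<in> space M. e \<in> G \<omega>} \<in> events"
    using ER by (auto simp: erdos_renyi_def indep_events_def)
  have "G \<in> measurable M (count_space (Pow (vertex_pairs n)))"
  proof (subst measurable_count_space_eq2)
    show "finite (Pow (vertex_pairs n))" using fin by simp
    show "G \<in> space M \<rightarrow> Pow (vertex_pairs n) \<and> (\<forall>E\<in>Pow (vertex_pairs n). G -` {E} \<inter> space M \<in> events)"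
    proof (intro conjI ballI)
      show "G \<in> space M \<rightarrow> Pow (vertex_pairs n)" using sub by auto
      fix E assume "E \<in> Pow (vertex_pairs n)"
      then have "G -` {E} \<inter> space M = {\<omega> \<in> space M. \<forall>e\<in>vertex_pairs n. e \<in> G \<omega> \<longleftrightarrow> e \<in> E}"
        using sub by blast
      also have "\<dots> \<in> events"
      proof (rule sets.sets_Collect_finite_All[OF _ fin])
        fix e assume e: "e \<in> vertex_pairs n"
        have "{\<omega> \<in> space M. e \<in> G \<omega> \<longleftrightarrow> e \<in> E} =
          (if e \<in> E then {\<omega> \<in> space M. e \<in> G \<omega>} else space M - {\<omega> \<in> space M. e \<in> G \<omega>})" by auto
        then show "{\<omega> \<in> space M. e \<in> G \<omega> \<longleftrightarrow> e \<in> E} \<in> events" using ev[OF e] by simp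
      qed
      finally show "G -` {E} \<inter> space M \<in> events" .
    qed
  qed
  then show ?thesis by (rule measurable_compose) simp
qed

lemma (in prob_space) AE_tendsto_0_imp_tendsto_in_prob:
  fixes D :: "nat \<Rightarrow> 'a \<Rightarrow> real"
  assumes meas: "\<And>n. n \<ge> N \<Longrightarrow> D n \<in> borel_measurable M"
    and lim: "AE \<omega> in M. (\<lambda>n. D n \<omega>) \<longlonglongrightarrow> 0" and \<epsilon>: "0 < \<epsilon>"
  shows "(\<lambda>n. prob {\<omega> \<in> space M. D n \<omega> > \<epsilon>}) \<longlonglongrightarrow> 0"
proof -
  define B where "B = (\<lambda>n. {\<omega> \<in> space M. D (n + N) \<omega> > \<epsilon>})"
  have B: "B n \<in> events" for n
    unfolding B_def using meas[of "n + N"] by measurable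
  have "(\<lambda>n. \<integral>\<omega>. indicator (B n) \<omega> \<partial>M) \<longlonglongrightarrow> (\<integral>\<omega>. 0 \<partial>M :: real)"
  proof (rule integral_dominated_convergence[where w="\<lambda>_. 1"])
    show "AE \<omega> in M. (\<lambda>n. indicator (B n) \<omega> :: real) \<longlonglongrightarrow> 0"
      using lim
    proof (rule AE_mp, intro AE_I2 impI)
      fix \<omega> assume "(\<lambda>n. D n \<omega>) \<longlonglongrightarrow> 0"
      then have "(\<lambda>n. D (n + N) \<omega>) \<longlonglongrightarrow> 0" by (rule LIMSEQ_ignore_initial_segment)
      then have "eventually (\<lambda>n. D (n + N) \<omega> < \<epsilon>) sequentially"
        using \<epsilon> by (rule order_tendstoD(2))
      then have "eventually (\<lambda>n. indicator (B n) \<omega> = (0::real)) sequentially"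
        by eventually_elim (auto simp: B_def)
      then show "(\<lambda>n. indicator (B n) \<omega> :: real) \<longlonglongrightarrow> 0"
        by (rule tendsto_eventually)
    qed
  qed (use B in \<open>auto simp: indicator_def\<close>)
  then have "(\<lambda>n. prob (B n)) \<longlonglongrightarrow> 0"
    using B by (simp add: Int_absorb1 sets.sets_into_space)
  then show ?thesis unfolding B_def by (rule LIMSEQ_offset)
qed

lemma degree_mat_adjacency_mat:
  "degree_mat (adjacency_mat n E) = Matrix.mat n n (\<lambda>(i, j). if i = j then vertex_degree n E i else 0)"
  by (rule eq_matI) (auto simp: degree_mat_def adjacency_mat_def vertex_degree_def)

lemma expectation_degree_mat:
  assumes M: "prob_space M" and ER: "erdos_renyi M n p G" and p: "0 \<le> p" "p \<le> 1"
  shows "expectation_mat M n (\<lambda>\<omega>. degree_mat (adjacency_mat n (G \<omega>)))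
    = Matrix.mat n n (\<lambda>(i, j). if i = j then (real n - 1) * p else 0)"
  using erdos_renyi_degree_tail(3)[OF M ER p, of _ 1]
  by (intro eq_matI) (auto simp: expectation_mat_def degree_mat_adjacency_mat)

theorem theorem1p4:
  fixes M :: "'w measure"
    and G :: "nat \<Rightarrow> 'w \<Rightarrow> nat set set"
    and p :: "nat \<Rightarrow> real" and p0 :: real and \<alpha> :: "nat \<Rightarrow> real"
    and A H H0 :: "nat \<Rightarrow> 'w \<Rightarrow> real mat"
    and \<mu> \<mu>0 :: "nat \<Rightarrow> 'w \<Rightarrow> complex measure"
  assumes "prob_space M"
    and "0 < p0" and "p0 < 1"
    and "\<And>n. n \<ge> 1 \<Longrightarrow> 0 < p n \<and> p n \<le> p0"
    and "filterlim (\<lambda>n. real n * p n / ln (real n)) at_top sequentially"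
    and "\<And>n. n \<ge> 1 \<Longrightarrow> erdos_renyi M n (p n) (G n)"
    and "\<And>n. \<alpha> n = (real n - 1) * p n - 1"
    and "\<And>n \<omega>. A n \<omega> = adjacency_mat n (G n \<omega>)"
    and "\<And>n \<omega>. H n \<omega> = nonbacktracking_op (A n \<omega>)"
    and "\<And>n \<omega>. H0 n \<omega> = partial_derandomization M n (A n) \<omega>"
    and "\<And>n \<omega>. \<mu> n \<omega> = empirical_spectral_measure
           (map_mat complex_of_real ((1 / sqrt (\<alpha> n)) \<cdot>\<^sub>m H n \<omega>))"
    and "\<And>n \<omega>. \<mu>0 n \<omega> = empirical_spectral_measure
           (map_mat complex_of_real ((1 / sqrt (\<alpha> n)) \<cdot>\<^sub>m H0 n \<omega>))"
  shows "measures_diff_conv_zero_as M \<mu> \<mu>0 \<and> measures_diff_conv_zero_prob M \<mu> \<mu>0"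
proof -
  interpret prob_space M by fact
  note ER = assms(6) and \<alpha> = assms(7)
  have p: "0 < p n \<and> p n \<le> 1" if "n \<ge> 1" for n using assms(3,4) that by force
  define a where "a = (\<lambda>\<omega> n i j. if {i, j} \<in> G n \<omega> then 1 else 0 :: real)"
  define d where "d = (\<lambda>\<omega> n. vertex_degree n (G n \<omega>))"
  have \<mu>: "\<mu> n \<omega> = empirical_spectral_measure (companion_mat n (a \<omega> n) (d \<omega> n) (sqrt (\<alpha> n)))" for n \<omega>
    by (simp add: assms(8,9,11) nonbacktracking_op_def degree_mat_adjacency_mat companion_mat_def a_def d_def)
       (simp add: adjacency_mat_def)
  have \<mu>0: "\<mu>0 n \<omega> = empirical_spectral_measure (companion_mat n (a \<omega> n) (\<lambda>i. \<alpha> n + 1) (sqrt (\<alpha> n)))"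
    if n: "n \<ge> 1" for n \<omega>
  proof -
    have \<alpha>': "\<alpha> n + 1 = (real n - 1) * p n" by (simp add: \<alpha>)
    have "expectation_mat M n (\<lambda>\<omega>. degree_mat (A n \<omega>)) = Matrix.mat n n (\<lambda>(i, j). if i = j then \<alpha> n + 1 else 0)"
      unfolding assms(8) \<alpha>' using expectation_degree_mat[OF assms(1) ER[OF n]] p[OF n] by simp
    then show ?thesis
      by (simp add: assms(10,12) partial_derandomization_def companion_mat_def a_def)
         (simp add: assms(8) adjacency_mat_def)
  qed
  have \<alpha>_top: "filterlim \<alpha> at_top sequentially"
  proof -
    have "filterlim (\<lambda>n. - 1 + (real n - 1) * p n) at_top sequentially"
      using p by (intro filterlim_tendsto_add_at_top[OF tendsto_const] expected_degree_at_top assms(5)) auto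
    then show ?thesis by (simp add: \<alpha>[abs_def])
  qed
  then have \<alpha>1: "eventually (\<lambda>n. 1 \<le> \<alpha> n) sequentially" by (simp add: filterlim_at_top)
  have conc_AE: "AE \<omega> in M. \<forall>\<eta>>0. eventually (\<lambda>n. \<forall>i<n.
      \<bar>vertex_degree n (G n \<omega>) i - (real n - 1) * p n\<bar> \<le> \<eta> * ((real n - 1) * p n)) sequentially"
    by (rule AE_erdos_renyi_degree_concentration[OF assms(1) _ assms(5)]) (use p ER in auto)
  have as: "AE \<omega> in M. (\<lambda>n. \<bar>integral\<^sup>L (\<mu> n \<omega>) f - integral\<^sup>L (\<mu>0 n \<omega>) f\<bar>) \<longlonglongrightarrow> 0"
    if f: "continuous_on UNIV f" "bounded (range f)" for f :: "complex \<Rightarrow> real"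
    using conc_AE
  proof (rule AE_mp, intro AE_I2 impI)
    fix \<omega> assume conc: "\<forall>\<eta>>0. eventually (\<lambda>n. \<forall>i<n.
      \<bar>vertex_degree n (G n \<omega>) i - (real n - 1) * p n\<bar> \<le> \<eta> * ((real n - 1) * p n)) sequentially"
    have dev: "eventually (\<lambda>n. \<forall>i<n. \<bar>d \<omega> n i - (\<alpha> n + 1)\<bar> \<le> \<eta> * \<alpha> n) sequentially" if \<eta>: "0 < \<eta>" for \<eta>
    proof -
      \<comment> \<open>The halving absorbs the difference between the expected degree \<open>\<alpha> + 1\<close> and \<open>\<alpha>\<close>.\<close>
      have "0 < \<eta> / 2" using \<eta> by simp
      from conc[rule_format, OF this] \<alpha>1 show ?thesis
      proof eventually_elim
        case (elim n)
        have "\<eta> / 2 * (\<alpha> n + 1) \<le> \<eta> / 2 * (2 * \<alpha> n)"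
          using elim(2) \<eta> by (intro mult_left_mono) auto
        moreover have "\<bar>d \<omega> n i - (\<alpha> n + 1)\<bar> \<le> \<eta> / 2 * (\<alpha> n + 1)" if "i < n" for i
          using elim(1) that by (simp add: d_def \<alpha>)
        ultimately show ?case by force
      qed
    qed
    have energy: "eventually (\<lambda>n. (\<Sum>i<n. \<Sum>j<n. (a \<omega> n i j)\<^sup>2) \<le> 3 * real n * \<alpha> n) sequentially"
      using dev[of 1, simplified] \<alpha>1
    proof eventually_elim
      case (elim n)
      have "(\<Sum>i<n. \<Sum>j<n. (a \<omega> n i j)\<^sup>2) = (\<Sum>i<n. d \<omega> n i)"
        unfolding d_def vertex_degree_def a_def by (intro sum.cong refl) simp
      also have "\<dots> \<le> (\<Sum>i<n. 3 * \<alpha> n)"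
      proof (rule sum_mono)
        fix i assume "i \<in> {..<n}"
        then have "\<bar>d \<omega> n i - (\<alpha> n + 1)\<bar> \<le> \<alpha> n" using elim(1) by simp
        then show "d \<omega> n i \<le> 3 * \<alpha> n" using elim(2) by linarith
      qed
      finally show ?case by simp
    qed
    have "(\<lambda>n. integral\<^sup>L (empirical_spectral_measure (companion_mat n (a \<omega> n) (d \<omega> n) (sqrt (\<alpha> n)))) f
       - integral\<^sup>L (empirical_spectral_measure (companion_mat n (a \<omega> n) (\<lambda>i. \<alpha> n + 1) (sqrt (\<alpha> n)))) f) \<longlonglongrightarrow> 0"
    proof (rule companion_spectra_close[OF _ _ energy dev f])
      show "a \<omega> n i j = a \<omega> n j i" for n i j by (simp add: a_def insert_commute)
      show "eventually (\<lambda>n. 0 < \<alpha> n) sequentially" using \<alpha>1 by eventually_elim simp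
    qed
    moreover have "eventually (\<lambda>n. integral\<^sup>L (empirical_spectral_measure (companion_mat n (a \<omega> n) (d \<omega> n) (sqrt (\<alpha> n)))) f
       - integral\<^sup>L (empirical_spectral_measure (companion_mat n (a \<omega> n) (\<lambda>i. \<alpha> n + 1) (sqrt (\<alpha> n)))) f
       = integral\<^sup>L (\<mu> n \<omega>) f - integral\<^sup>L (\<mu>0 n \<omega>) f) sequentially"
      using eventually_ge_at_top[of "1::nat"] by eventually_elim (simp add: \<mu> \<mu>0)
    ultimately have "(\<lambda>n. integral\<^sup>L (\<mu> n \<omega>) f - integral\<^sup>L (\<mu>0 n \<omega>) f) \<longlonglongrightarrow> 0"
      by (rule Lim_transform_eventually)
    then show "(\<lambda>n. \<bar>integral\<^sup>L (\<mu> n \<omega>) f - integral\<^sup>L (\<mu>0 n \<omega>) f\<bar>) \<longlonglongrightarrow> 0"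
      by (rule tendsto_rabs_zero)
  qed
  have meas: "(\<lambda>\<omega>. \<bar>integral\<^sup>L (\<mu> n \<omega>) f - integral\<^sup>L (\<mu>0 n \<omega>) f\<bar>) \<in> borel_measurable M"
    if n: "n \<ge> 1" for n and f :: "complex \<Rightarrow> real"
    unfolding \<mu> \<mu>0[OF n] a_def d_def
    by (rule erdos_renyi_measurable[OF assms(1) ER[OF n], of "\<lambda>E.
        \<bar>integral\<^sup>L (empirical_spectral_measure (companion_mat n (\<lambda>i j. if {i, j} \<in> E then 1 else 0) (vertex_degree n E) (sqrt (\<alpha> n)))) f
       - integral\<^sup>L (empirical_spectral_measure (companion_mat n (\<lambda>i j. if {i, j} \<in> E then 1 else 0) (\<lambda>i. \<alpha> n + 1) (sqrt (\<alpha> n)))) f\<bar>"])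
  show ?thesis
    unfolding measures_diff_conv_zero_as_def measures_diff_conv_zero_prob_def
  proof (intro conjI allI impI)
    fix f :: "complex \<Rightarrow> real" and \<epsilon> :: real
    assume f: "continuous_on UNIV f" "bounded (range f)" and \<epsilon>: "\<epsilon> > 0"
    show "(\<lambda>n. prob {\<omega> \<in> space M. \<bar>integral\<^sup>L (\<mu> n \<omega>) f - integral\<^sup>L (\<mu>0 n \<omega>) f\<bar> > \<epsilon>}) \<longlonglongrightarrow> 0"
      by (rule AE_tendsto_0_imp_tendsto_in_prob[OF meas as[OF f] \<epsilon>])
  qed (rule as)
qed

end
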